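(* Let $p$ be a prime and $n\ge 2$. Let $G_n$ be the group (with respect to composition) of polynomial permutations of $\mathbb{Z}_{p^n}$. The Sylow $p$-subgroups of $G_n$ are in bijective correspondence with pairs $(C,\bar\varphi)$, where $C$ is a cyclic subgroup of order $p$ of $S_p$, $\varphi\colon\mathbb{Z}_p\to\mathbb{Z}_p\setminus\{0\}$ is a function and $\bar\varphi$ is its class with respect to the equivalence relation of multiplication by a non-zero constant. The subgroup corresponding to $(C,\bar\varphi)$ is $$S_{(C,\bar\varphi)}=\Big\{[f]_{p^n}\in G_n \;\Big|\; [f]_p\in C,\ [f']_p(x)=\frac{\varphi([f]_p(x))}{\varphi(x)}\ \text{for all } x\in\mathbb{Z}_p\Big\}.$$
   Context: $\mathbb{Z}_{p^n}=\mathbb{Z}/p^n\mathbb{Z}$ (integers mod $p^n$). $S_p$ is the symmetric group on the $p$ elements of $\mathbb{Z}_p$. For $f\in\mathbb{Z}[x]$, $[f]_{p^n}$ denotes the function $\mathbb{Z}_{p^n}\to\mathbb{Z}_{p^n}$ induced by $f$, and $[f']_p$ the function on $\mathbb{Z}_p$ induced by the formal derivative $f'$ of $f$. For $n\ge2$, $[f]_{p^n}$ determines both $[f]_p$ and $[f']_p$. A polynomial permutation of $\mathbb{Z}_{p^n}$ is a bijection of the form $[f]_{p^n}$ with $f\in\mathbb{Z}[x]$. *)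

theory Defs
  imports
    "HOL-Number_Theory.Residues"
    "HOL-Algebra.Bij"
    "HOL-Algebra.Elementary_Groups"
    "HOL-Computational_Algebra.Polynomial"
begin

abbreviation Zmod :: "int \<Rightarrow> int set" where
  "Zmod m \<equiv> carrier (residue_ring m)"

text \<open>The function on the integers mod \<open>m\<close> induced by \<open>f\<close>. It is extensional (undefined outside
  \<^term>\<open>Zmod m\<close>), so that it can be an element of \<^term>\<open>BijGroup (Zmod m)\<close>.\<close>

definition induced :: "int \<Rightarrow> int poly \<Rightarrow> int \<Rightarrow> int" where
  "induced m f = (\<lambda>x\<in>Zmod m. poly f x mod m)"

definition poly_perm_group :: "int \<Rightarrow> (int \<Rightarrow> int) monoid" where
  "poly_perm_group m = (BijGroup (Zmod m))\<lparr>carrier := Bij (Zmod m) \<inter> range (induced m)\<rparr>"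

text \<open>Meaningful for finite groups only (\<^const>\<open>Coset.order\<close> is 0 for an infinite one).\<close>

definition sylow_subgroups :: "nat \<Rightarrow> ('a, 'b) monoid_scheme \<Rightarrow> 'a set set" where
  "sylow_subgroups p G = {H. subgroup H G \<and> card H = p ^ multiplicity p (Coset.order G)}"

definition cyclic_subgroups :: "nat \<Rightarrow> ('a, 'b) monoid_scheme \<Rightarrow> 'a set set" where
  "cyclic_subgroups k G = {C. subgroup C G \<and> cyclic_group (G\<lparr>carrier := C\<rparr>) \<and> card C = k}"

definition nonzero_funs :: "int \<Rightarrow> (int \<Rightarrow> int) set" where
  "nonzero_funs p = Zmod p \<rightarrow>\<^sub>E (Zmod p - {\<zero>\<^bsub>residue_ring p\<^esub>})"

definition scalar_rel :: "int \<Rightarrow> ((int \<Rightarrow> int) \<times> (int \<Rightarrow> int)) set" where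
  "scalar_rel p = {(\<phi>, \<psi>). \<phi> \<in> nonzero_funs p \<and> \<psi> \<in> nonzero_funs p \<and>
     (\<exists>c \<in> Zmod p - {\<zero>\<^bsub>residue_ring p\<^esub>}. \<psi> = (\<lambda>x\<in>Zmod p. c \<otimes>\<^bsub>residue_ring p\<^esub> \<phi> x))}"

text \<open>The set attached to \<open>C\<close> and a representative \<open>\<phi>\<close> of a class. For \<open>n \<ge> 2\<close> the conditions depend
  only on \<^term>\<open>induced (p ^ n) f\<close>, not on the polynomial \<open>f\<close>; see \<open>induced_determines\<close> below.\<close>

definition S_subgroup :: "int \<Rightarrow> nat \<Rightarrow> (int \<Rightarrow> int) set \<Rightarrow> (int \<Rightarrow> int) \<Rightarrow> (int \<Rightarrow> int) set" where
  "S_subgroup p n C \<phi> = {induced (p ^ n) f | f.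
     induced (p ^ n) f \<in> carrier (poly_perm_group (p ^ n)) \<and>
     induced p f \<in> C \<and>
     (\<forall>x\<in>Zmod p. induced p (pderiv f) x =
        \<phi> (induced p f x) \<otimes>\<^bsub>residue_ring p\<^esub> inv\<^bsub>residue_ring p\<^esub> (\<phi> x))}"


lemma Zmod_eq: "Zmod m = {0..m - 1}"
  by (simp add: residue_ring_def)

lemma poly_mod_arg: "poly f (x mod m) mod m = poly f x mod (m::int)"
proof -
  have "[poly f (x mod m) = poly f x] (mod m)"
  proof (induction f)
    case (pCons a f)
    have "[a + (x mod m) * poly f (x mod m) = a + x * poly f x] (mod m)"
      using pCons by (intro cong_add cong_mult cong_refl) (simp_all add: cong_def)
    thus ?case by simp
  qed simp
  thus ?thesis by (simp add: cong_def)
qed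

lemma induced_pcompose:
  assumes "m > 0"
  shows "compose (Zmod m) (induced m f) (induced m g) = induced m (pcompose f g)"
  using assms by (auto simp: induced_def compose_def Zmod_eq poly_pcompose poly_mod_arg)

lemma group_poly_perm_group:
  assumes "m > 0"
  shows "group (poly_perm_group m)"
proof -
  interpret B: group "BijGroup (Zmod m)" by (rule group_BijGroup)
  let ?H = "Bij (Zmod m) \<inter> range (induced m)"
  have fin: "finite (Zmod m)" by (simp add: Zmod_eq)
  have carr: "carrier (BijGroup (Zmod m)) = Bij (Zmod m)" by (simp add: BijGroup_def)
  have "Bij (Zmod m) \<subseteq> Zmod m \<rightarrow>\<^sub>E Zmod m"
    by (auto simp: Bij_def bij_betw_def PiE_def)
  hence finB: "finite (Bij (Zmod m))"
    by (rule finite_subset) (intro finite_PiE fin)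
  have one: "(\<lambda>x\<in>Zmod m. x) = induced m [:0, 1:]"
    by (auto simp: induced_def Zmod_eq)
  have mult: "a \<otimes>\<^bsub>BijGroup (Zmod m)\<^esub> b \<in> ?H" if "a \<in> ?H" "b \<in> ?H" for a b
    using that induced_pcompose[OF assms] by (auto simp: BijGroup_def compose_Bij)
  have oneH: "\<one>\<^bsub>BijGroup (Zmod m)\<^esub> \<in> ?H"
    using one id_Bij[of "Zmod m"] by (auto simp: BijGroup_def)
  have pow: "a [^]\<^bsub>BijGroup (Zmod m)\<^esub> (k::nat) \<in> ?H" if "a \<in> ?H" for a k
    by (induction k) (use oneH mult that in auto)
  have "subgroup ?H (BijGroup (Zmod m))"
  proof (rule B.subgroupI)
    fix a assume a: "a \<in> ?H"
    hence ac: "a \<in> carrier (BijGroup (Zmod m))" by (simp add: carr)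
    let ?k = "Coset.order (BijGroup (Zmod m))"
    have k: "?k > 0" using finB B.order_gt_0_iff_finite carr by simp
    have "a [^]\<^bsub>BijGroup (Zmod m)\<^esub> (?k - 1) \<otimes>\<^bsub>BijGroup (Zmod m)\<^esub> a = \<one>\<^bsub>BijGroup (Zmod m)\<^esub>"
      using B.pow_order_eq_1[OF ac] k by (metis B.nat_pow_Suc Suc_diff_1)
    hence "inv\<^bsub>BijGroup (Zmod m)\<^esub> a = a [^]\<^bsub>BijGroup (Zmod m)\<^esub> (?k - 1)"
      using B.inv_equality ac by simp
    thus "inv\<^bsub>BijGroup (Zmod m)\<^esub> a \<in> ?H" using pow a by metis
  qed (use oneH mult carr in auto)
  thus ?thesis unfolding poly_perm_group_def
    by (rule subgroup.subgroup_is_group) (rule group_BijGroup)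
qed

lemma poly_add_mult_cong:
  "[poly f (x + h) = poly f x + h * poly (pderiv f) x] (mod h\<^sup>2)" for x h :: int
proof (induction f)
  case (pCons a f)
  have "[a + (x + h) * poly f (x + h) = a + (x + h) * (poly f x + h * poly (pderiv f) x)] (mod h\<^sup>2)"
    using pCons by (intro cong_add cong_mult cong_refl)
  moreover have "a + (x + h) * (poly f x + h * poly (pderiv f) x) =
      (poly (pCons a f) x + h * poly (pderiv (pCons a f)) x) + h\<^sup>2 * poly (pderiv f) x"
    by (simp add: pderiv_pCons algebra_simps power2_eq_square)
  ultimately have "[poly (pCons a f) (x + h) =
      (poly (pCons a f) x + h * poly (pderiv (pCons a f)) x) + h\<^sup>2 * poly (pderiv f) x] (mod h\<^sup>2)"
    by simp
  thus ?case by (simp add: cong_def del: poly_pCons)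
qed simp

lemma induced_determines:
  fixes p :: int
  assumes "p > 1" "n \<ge> 2" and eq: "induced (p ^ n) f = induced (p ^ n) g"
  shows "induced p f = induced p g" and "induced p (pderiv f) = induced p (pderiv g)"
proof -
  have all: "[poly f x = poly g x] (mod p ^ n)" for x
  proof -
    have "x mod p ^ n \<in> Zmod (p ^ n)" using assms by (simp add: Zmod_eq)
    with fun_cong[OF eq, of "x mod p ^ n"] show ?thesis
      by (simp add: induced_def cong_def poly_mod_arg)
  qed
  have sq: "[poly f x = poly g x] (mod p\<^sup>2)" for x
    using all le_imp_power_dvd[OF assms(2)] by (rule cong_dvd_modulus)
  have one: "[poly f x = poly g x] (mod p)" for x
    using sq by (rule cong_dvd_modulus) (simp add: power2_eq_square)
  show "induced p f = induced p g"
    using one by (simp add: induced_def cong_def)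
  have "[poly (pderiv f) x = poly (pderiv g) x] (mod p)" for x
  proof -
    have "[poly f x + p * poly (pderiv f) x = poly g x + p * poly (pderiv g) x] (mod p\<^sup>2)"
      by (rule cong_trans[OF cong_trans[OF cong_sym[OF poly_add_mult_cong] sq] poly_add_mult_cong])
    from cong_diff[OF this sq[of x]]
    have "[p * poly (pderiv f) x = p * poly (pderiv g) x] (mod p\<^sup>2)" by simp
    thus ?thesis
      using assms(1) by (simp add: cong_iff_dvd_diff power2_eq_square flip: right_diff_distrib)
  qed
  thus "induced p (pderiv f) = induced p (pderiv g)"
    by (simp add: induced_def cong_def)
qed

lemma equiv_scalar_rel:
  assumes "prime p"
  shows "equiv (nonzero_funs (int p)) (scalar_rel (int p))"
proof -
  interpret residues_prime p "residue_ring (int p)"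
    using assms by unfold_locales auto
  let ?R = "residue_ring (int p)"
  have in_carr: "\<phi> x \<in> Zmod (int p)" if "\<phi> \<in> nonzero_funs (int p)" "x \<in> Zmod (int p)" for \<phi> x
    using that by (auto simp: nonzero_funs_def)
  show ?thesis
  proof (rule equivI)
    show "scalar_rel (int p) \<subseteq> nonzero_funs (int p) \<times> nonzero_funs (int p)"
      by (auto simp: scalar_rel_def)
    show "refl_on (nonzero_funs (int p)) (scalar_rel (int p))"
    proof (rule refl_onI)
      fix \<phi> assume a: "\<phi> \<in> nonzero_funs (int p)"
      hence "\<phi> = (\<lambda>x\<in>Zmod (int p). \<one>\<^bsub>?R\<^esub> \<otimes>\<^bsub>?R\<^esub> \<phi> x)"
        using in_carr[OF a] by (auto simp: nonzero_funs_def PiE_def extensional_def fun_eq_iff)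
      moreover have "\<one>\<^bsub>?R\<^esub> \<in> Zmod (int p) - {\<zero>\<^bsub>?R\<^esub>}"
        using one_closed one_not_zero by blast
      ultimately show "(\<phi>, \<phi>) \<in> scalar_rel (int p)"
        unfolding scalar_rel_def using a by blast
    qed
    show "sym (scalar_rel (int p))"
    proof (rule symI)
      fix \<phi> \<psi> assume "(\<phi>, \<psi>) \<in> scalar_rel (int p)"
      then obtain c where a: "\<phi> \<in> nonzero_funs (int p)" "\<psi> \<in> nonzero_funs (int p)"
        and c: "c \<in> Zmod (int p) - {\<zero>\<^bsub>?R\<^esub>}" and \<psi>: "\<psi> = (\<lambda>x\<in>Zmod (int p). c \<otimes>\<^bsub>?R\<^esub> \<phi> x)"
        unfolding scalar_rel_def by blast
      have u: "c \<in> Units ?R" using c field_Units by blast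
      hence i: "inv\<^bsub>?R\<^esub> c \<in> Zmod (int p) - {\<zero>\<^bsub>?R\<^esub>}"
        using Units_inv_Units field_Units by blast
      have "inv\<^bsub>?R\<^esub> c \<otimes>\<^bsub>?R\<^esub> (c \<otimes>\<^bsub>?R\<^esub> \<phi> x) = \<phi> x" if "x \<in> Zmod (int p)" for x
        using u c in_carr[OF a(1) that] by (simp add: Units_l_inv flip: m_assoc)
      hence "\<phi> = (\<lambda>x\<in>Zmod (int p). inv\<^bsub>?R\<^esub> c \<otimes>\<^bsub>?R\<^esub> \<psi> x)"
        using a(1) unfolding \<psi>
        by (auto simp: nonzero_funs_def PiE_def extensional_def fun_eq_iff)
      thus "(\<psi>, \<phi>) \<in> scalar_rel (int p)"
        unfolding scalar_rel_def using a i by blast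
    qed
    show "trans (scalar_rel (int p))"
    proof (rule transI)
      fix \<phi> \<psi> \<chi> assume "(\<phi>, \<psi>) \<in> scalar_rel (int p)" "(\<psi>, \<chi>) \<in> scalar_rel (int p)"
      then obtain c d where a: "\<phi> \<in> nonzero_funs (int p)" "\<chi> \<in> nonzero_funs (int p)"
        and c: "c \<in> Zmod (int p) - {\<zero>\<^bsub>?R\<^esub>}" and \<psi>: "\<psi> = (\<lambda>x\<in>Zmod (int p). c \<otimes>\<^bsub>?R\<^esub> \<phi> x)"
        and d: "d \<in> Zmod (int p) - {\<zero>\<^bsub>?R\<^esub>}" and \<chi>: "\<chi> = (\<lambda>x\<in>Zmod (int p). d \<otimes>\<^bsub>?R\<^esub> \<psi> x)"
        unfolding scalar_rel_def by blast
      have "d \<otimes>\<^bsub>?R\<^esub> c \<in> Zmod (int p) - {\<zero>\<^bsub>?R\<^esub>}"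
        using c d integral by blast
      moreover have "\<chi> = (\<lambda>x\<in>Zmod (int p). (d \<otimes>\<^bsub>?R\<^esub> c) \<otimes>\<^bsub>?R\<^esub> \<phi> x)"
        unfolding \<chi> \<psi> using c d in_carr[OF a(1)] m_assoc by (auto simp: fun_eq_iff)
      ultimately show "(\<phi>, \<chi>) \<in> scalar_rel (int p)"
        unfolding scalar_rel_def using a by blast
    qed
  qed
qed

end

theory Submission
  imports Defs "HOL-Combinatorics.Permutations" "HOL-Algebra.Product_Groups"
begin

text \<open>Write \<open>G\<close> for the group of polynomial permutations of \<open>\<int>/p\<^sup>n\<close> and send \<open>[f]\<close> to the pair
  consisting of \<open>\<sigma> = [f]\<close> mod \<open>p\<close> and \<open>u = [f']\<close> mod \<open>p\<close>. By Hensel's argument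
  (\<open>induced_Bij_prime_power_iff\<close>) the pairs that occur have \<open>\<sigma>\<close> a permutation of \<open>\<int>/p\<close> and \<open>u\<close>
  without zeros, and by Hermite interpolation mod \<open>p\<close> all such pairs occur. Two polynomials with
  the same pair differ by an element of one fixed additive group of functions, which is a
  \<open>p\<close>-group; so all fibres of the map have the same size \<open>p\<^sup>k\<close> (\<open>card_fibre\<close>, \<open>card_flat\<close>), and
  \<open>|G| = p! (p - 1)\<^sup>p p\<^sup>k\<close>. A Sylow \<open>p\<close>-subgroup therefore has order \<open>p \<sqdot> p\<^sup>k\<close>
  (\<open>sylow_order\<close>).

  By the chain rule, the pairs multiply by \<open>(\<sigma>, u) (\<tau>, v) = (\<sigma> \<circ> \<tau>, (u \<circ> \<tau>) v)\<close>. Hence, for a group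
  \<open>C\<close> of order \<open>p\<close> and a function \<open>\<phi>\<close>, the pairs \<open>(\<sigma>, (\<phi> \<circ> \<sigma>) / \<phi>)\<close> with \<open>\<sigma>\<close> in \<open>C\<close> form a group of
  order \<open>p\<close>, and its preimage is the subgroup attached to \<open>(C, \<phi>)\<close>, which has the Sylow order.

  Conversely, let \<open>H\<close> have the Sylow order. An element of \<open>H\<close> that is the identity mod \<open>p\<close> has
  derivative 1 mod \<open>p\<close>: the values of its derivative are residues of \<open>p\<close>-power order, and
  Fermat leaves only 1. So on \<open>H\<close> the derivative \<open>u\<^sub>\<sigma>\<close> is a function of the reduction \<open>\<sigma>\<close>
  (\<open>der_determined_by_red\<close>), and counting shows that the reductions form a group \<open>C\<close> of order \<open>p\<close>
  (\<open>card_red_image\<close>). Such a group acts regularly on the \<open>p\<close> residues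
  (\<open>prime_order_permutations_regular\<close>), which makes the cocycle \<open>u\<close> a coboundary: fix a point
  \<open>x\<^sub>0\<close> and let \<open>\<phi>(\<sigma> x\<^sub>0) = u\<^sub>\<sigma>(x\<^sub>0)\<close>. Then \<open>H\<close> is contained in the subgroup of \<open>(C, \<phi>)\<close>, and the two
  have the same order. Transitivity of \<open>C\<close> also shows that \<open>\<phi>\<close> is determined up to a constant
  factor (\<open>S_subgroup_inj\<close>).\<close>

section \<open>Permutation groups of prime order\<close>

lemma card_eq_card_times_fibre:
  assumes "finite A" "finite B" "f ` A \<subseteq> B" and "\<And>b. b \<in> B \<Longrightarrow> card {a \<in> A. f a = b} = k"
  shows "card A = card B * k"
  using sum_fun_comp[OF assms(1-3), of "\<lambda>_. 1::nat"] assms(4) by simp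

text \<open>Restriction to \<open>S\<close> turns permutations of the whole type that fix the complement of \<open>S\<close> into
  the extensional bijections that make up \<open>BijGroup S\<close>, for which the count is known.\<close>

lemma card_Bij:
  assumes "finite S"
  shows "card (Bij S) = fact (card S)"
proof -
  have "bij_betw (\<lambda>f. restrict f S) {f. f permutes S} (Bij S)"
  proof (rule bij_betw_byWitness[where f' = "\<lambda>f x. if x \<in> S then f x else x"])
    show "(\<lambda>f. restrict f S) ` {f. f permutes S} \<subseteq> Bij S"
      by (auto simp: Bij_def permutes_imp_bij)
    show "(\<lambda>f x. if x \<in> S then f x else x) ` Bij S \<subseteq> {f. f permutes S}"
    proof clarify
      fix f assume "f \<in> Bij S"
      hence "bij_betw f S S" by (simp add: Bij_def)
      hence "bij_betw (\<lambda>x. if x \<in> S then f x else x) S S"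
        by (simp cong: bij_betw_cong)
      thus "(\<lambda>x. if x \<in> S then f x else x) permutes S"
        by (rule bij_imp_permutes) simp
    qed
  qed (auto simp: fun_eq_iff permutes_not_in Bij_def extensional_def)
  thus ?thesis
    using bij_betw_same_card card_permutations[OF refl assms] by metis
qed

lemma carrier_BijGroup: "carrier (BijGroup S) = Bij S"
  by (simp add: BijGroup_def)

lemma finite_Bij_Zmod: "finite (Bij (Zmod k))"
proof (rule finite_subset)
  show "Bij (Zmod k) \<subseteq> Zmod k \<rightarrow>\<^sub>E Zmod k" by (auto simp: Bij_def bij_betw_def PiE_def)
  show "finite (Zmod k \<rightarrow>\<^sub>E Zmod k)" by (intro finite_PiE) (simp_all add: Zmod_eq)
qed

text \<open>A nontrivial element of a group of prime order generates a subgroup whose order divides the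
  prime and is not 1; so cyclicity is automatic.\<close>

lemma cyclic_subgroups_prime:
  assumes "group G" "prime p"
  shows "cyclic_subgroups p G = {C. subgroup C G \<and> card C = p}"
proof -
  have "cyclic_group (G\<lparr>carrier := C\<rparr>)" if C: "subgroup C G" "card C = p" for C
  proof -
    interpret C: group "G\<lparr>carrier := C\<rparr>"
      using C(1) assms(1) by (rule subgroup.subgroup_is_group)
    have "\<one>\<^bsub>G\<^esub> \<in> C" using C(1) by (rule subgroup.one_closed)
    moreover have "C \<noteq> {\<one>\<^bsub>G\<^esub>}"
      using C(2) assms(2) by (metis card_1_singleton_iff One_nat_def not_prime_1)
    ultimately obtain x where x: "x \<in> C" "x \<noteq> \<one>\<^bsub>G\<^esub>" by blast
    let ?X = "generate (G\<lparr>carrier := C\<rparr>) {x}"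
    have sub: "subgroup ?X (G\<lparr>carrier := C\<rparr>)"
      using x by (intro C.generate_is_subgroup) simp
    have fin: "finite C" using C(2) assms(2) by (metis card.infinite not_prime_0)
    have XC: "?X \<subseteq> C" using subgroup.subset[OF sub] by simp
    have "Coset.order (G\<lparr>carrier := C\<rparr>) = p" using C(2) by (simp add: Coset.order_def)
    hence "card ?X dvd p" using C.lagrange[OF sub] by (metis dvd_triv_right)
    moreover have "card ?X \<noteq> 1"
    proof
      assume "card ?X = 1"
      moreover have "x \<in> ?X" by (simp add: generate.incl)
      moreover have "\<one>\<^bsub>G\<^esub> \<in> ?X" using subgroup.one_closed[OF sub] by simp
      ultimately show False using x(2) by (auto simp: card_1_singleton_iff)
    qed
    ultimately have "card ?X = card C" using assms(2) unfolding C(2) prime_nat_iff by blast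
    hence "?X = C" using XC fin by (simp add: card_subset_eq)
    hence "subgroup_generated (G\<lparr>carrier := C\<rparr>) {x} = G\<lparr>carrier := C\<rparr>"
      using x by (simp add: subgroup_generated_def)
    thus ?thesis unfolding C.cyclic_group_alt by blast
  qed
  thus ?thesis unfolding cyclic_subgroups_def by blast
qed

lemma BijGroup_mult_apply:
  "\<sigma> \<in> Bij S \<Longrightarrow> \<tau> \<in> Bij S \<Longrightarrow> x \<in> S \<Longrightarrow> (\<sigma> \<otimes>\<^bsub>BijGroup S\<^esub> \<tau>) x = \<sigma> (\<tau> x)"
  by (simp add: BijGroup_def compose_def)

lemma BijGroup_one_apply: "x \<in> S \<Longrightarrow> \<one>\<^bsub>BijGroup S\<^esub> x = x"
  by (simp add: BijGroup_def)

lemma Bij_apply: "\<sigma> \<in> Bij S \<Longrightarrow> x \<in> S \<Longrightarrow> \<sigma> x \<in> S"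
  using Bij_imp_funcset by blast

lemma BijGroup_inv_apply:
  assumes "\<sigma> \<in> Bij S" "x \<in> S"
  shows "(inv\<^bsub>BijGroup S\<^esub> \<sigma>) (\<sigma> x) = x" and "\<sigma> ((inv\<^bsub>BijGroup S\<^esub> \<sigma>) x) = x"
proof -
  interpret B: group "BijGroup S" by (rule group_BijGroup)
  have car: "carrier (BijGroup S) = Bij S" by (simp add: BijGroup_def)
  have inv: "inv\<^bsub>BijGroup S\<^esub> \<sigma> \<in> Bij S" using B.inv_closed assms(1) car by simp
  have "inv\<^bsub>BijGroup S\<^esub> \<sigma> \<otimes>\<^bsub>BijGroup S\<^esub> \<sigma> = \<one>\<^bsub>BijGroup S\<^esub>"
       "\<sigma> \<otimes>\<^bsub>BijGroup S\<^esub> inv\<^bsub>BijGroup S\<^esub> \<sigma> = \<one>\<^bsub>BijGroup S\<^esub>"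
    using assms(1) car by (simp_all add: B.l_inv B.r_inv)
  thus "(inv\<^bsub>BijGroup S\<^esub> \<sigma>) (\<sigma> x) = x" "\<sigma> ((inv\<^bsub>BijGroup S\<^esub> \<sigma>) x) = x"
    using BijGroup_mult_apply[OF inv assms] BijGroup_mult_apply[OF assms(1) inv assms(2)]
      BijGroup_one_apply[OF assms(2)] by simp_all
qed

text \<open>A permutation group of prime order \<open>|S|\<close> moves some point \<open>x0\<close>. The stabilizer of \<open>x0\<close> is a
  proper subgroup of a group of prime order, hence trivial, so the orbit map at \<open>x0\<close> is injective;
  as the group has as many elements as \<open>S\<close>, it is also onto.\<close>

lemma prime_order_permutations_regular:
  assumes C: "subgroup C (BijGroup S)" and card: "card C = card S" "prime (card S)"
  shows "\<exists>x0\<in>S. bij_betw (\<lambda>\<sigma>. \<sigma> x0) C S"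
proof -
  interpret B: group "BijGroup S" by (rule group_BijGroup)
  interpret C: group "(BijGroup S)\<lparr>carrier := C\<rparr>"
    using C group_BijGroup by (rule subgroup.subgroup_is_group)
  have CB: "C \<subseteq> Bij S" using subgroup.subset[OF C] by (simp add: BijGroup_def)
  have fin: "finite C" "finite S" 
    using card prime_gt_0_nat[OF card(2)] card_ge_0_finite by metis+
  have "C \<noteq> {\<one>\<^bsub>BijGroup S\<^esub>}" using card by (metis card_1_singleton_iff One_nat_def not_prime_1)
  then obtain \<sigma> where \<sigma>: "\<sigma> \<in> C" "\<sigma> \<noteq> \<one>\<^bsub>BijGroup S\<^esub>"
    using subgroup.one_closed[OF C] by blast
  obtain x0 where x0: "x0 \<in> S" "\<sigma> x0 \<noteq> x0"
  proof -
    have "\<sigma> = \<one>\<^bsub>BijGroup S\<^esub>" if "\<forall>x\<in>S. \<sigma> x = x"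
      using that \<sigma>(1) CB
      by (intro extensionalityI[of _ S]) (auto simp: BijGroup_def Bij_def)
    thus ?thesis using \<sigma>(2) that by blast
  qed
  define T where "T = {\<tau> \<in> C. \<tau> x0 = x0}"
  have "subgroup T ((BijGroup S)\<lparr>carrier := C\<rparr>)"
  proof (rule C.subgroupI)
    show "T \<subseteq> carrier ((BijGroup S)\<lparr>carrier := C\<rparr>)" by (auto simp: T_def)
    have one: "\<one>\<^bsub>BijGroup S\<^esub> \<in> T"
      using subgroup.one_closed[OF C] x0 by (simp add: T_def BijGroup_one_apply)
    thus "T \<noteq> {}" by blast
    fix \<tau> assume \<tau>: "\<tau> \<in> T"
    hence \<tau>': "\<tau> \<in> C" "\<tau> x0 = x0" "\<tau> \<in> Bij S" using CB by (auto simp: T_def)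
    have "inv\<^bsub>BijGroup S\<^esub> \<tau> \<in> T"
      using \<tau>' x0 BijGroup_inv_apply(1)[OF \<tau>'(3) x0(1)] subgroup.m_inv_closed[OF C]
      by (simp add: T_def)
    thus "inv\<^bsub>(BijGroup S)\<lparr>carrier := C\<rparr>\<^esub> \<tau> \<in> T"
      using B.m_inv_consistent[OF C \<tau>'(1)] by simp
    fix \<rho> assume \<rho>: "\<rho> \<in> T"
    hence \<rho>': "\<rho> \<in> C" "\<rho> x0 = x0" "\<rho> \<in> Bij S" using CB by (auto simp: T_def)
    show "\<tau> \<otimes>\<^bsub>(BijGroup S)\<lparr>carrier := C\<rparr>\<^esub> \<rho> \<in> T"
      using \<tau>' \<rho>' x0 subgroup.m_closed[OF C \<tau>'(1) \<rho>'(1)] by (simp add: T_def BijGroup_mult_apply)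
  qed
  from C.lagrange[OF this] have "card T dvd Coset.order ((BijGroup S)\<lparr>carrier := C\<rparr>)"
    by (metis dvd_triv_right)
  hence "card T dvd card S" using card by (simp add: Coset.order_def)
  moreover have "card T \<noteq> card S"
  proof
    assume "card T = card S"
    hence "T = C" using fin card by (intro card_subset_eq) (auto simp: T_def)
    thus False using \<sigma> x0 by (auto simp: T_def)
  qed
  ultimately have "card T = 1" using card(2) unfolding prime_nat_iff by blast
  moreover have "\<one>\<^bsub>BijGroup S\<^esub> \<in> T"
    using subgroup.one_closed[OF C] x0 by (simp add: T_def BijGroup_one_apply)
  ultimately have T: "T = {\<one>\<^bsub>BijGroup S\<^esub>}" by (auto simp: card_1_singleton_iff)
  have inj: "inj_on (\<lambda>\<sigma>. \<sigma> x0) C"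
  proof (rule inj_onI)
    fix \<tau> \<rho> assume a: "\<tau> \<in> C" "\<rho> \<in> C" "\<tau> x0 = \<rho> x0"
    have inv: "inv\<^bsub>BijGroup S\<^esub> \<rho> \<in> C" using C a(2) by (rule subgroup.m_inv_closed)
    have B: "\<tau> \<in> Bij S" "\<rho> \<in> Bij S" "inv\<^bsub>BijGroup S\<^esub> \<rho> \<in> Bij S" 
      using subsetD[OF CB a(1)] subsetD[OF CB a(2)] subsetD[OF CB inv] .
    have "(inv\<^bsub>BijGroup S\<^esub> \<rho> \<otimes>\<^bsub>BijGroup S\<^esub> \<tau>) x0 = x0"
      unfolding BijGroup_mult_apply[OF B(3,1) x0(1)] a(3) by (rule BijGroup_inv_apply(1)[OF B(2) x0(1)])
    hence "inv\<^bsub>BijGroup S\<^esub> \<rho> \<otimes>\<^bsub>BijGroup S\<^esub> \<tau> \<in> T"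
      using subgroup.m_closed[OF C inv a(1)] by (simp add: T_def)
    hence "inv\<^bsub>BijGroup S\<^esub> \<rho> \<otimes>\<^bsub>BijGroup S\<^esub> \<tau> = \<one>\<^bsub>BijGroup S\<^esub>" by (simp add: T)
    moreover have car: "\<tau> \<in> carrier (BijGroup S)" "\<rho> \<in> carrier (BijGroup S)"
      using subsetD[OF subgroup.subset[OF C] a(1)] subsetD[OF subgroup.subset[OF C] a(2)] .
    ultimately have "inv\<^bsub>BijGroup S\<^esub> \<tau> = inv\<^bsub>BijGroup S\<^esub> \<rho>"
      using B.inv_equality[OF _ car(1) B.inv_closed[OF car(2)]] by simp
    thus "\<tau> = \<rho>" using B.inv_inv[OF car(1)] B.inv_inv[OF car(2)] by metis
  qed
  have "(\<lambda>\<sigma>. \<sigma> x0) ` C = S"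
  proof (rule card_subset_eq)
    show "(\<lambda>\<sigma>. \<sigma> x0) ` C \<subseteq> S" 
      by (rule image_subsetI) (rule Bij_apply[OF subsetD[OF CB] x0(1)])
    show "card ((\<lambda>\<sigma>. \<sigma> x0) ` C) = card S" using inj card by (simp add: card_image)
  qed fact
  hence "bij_betw (\<lambda>\<sigma>. \<sigma> x0) C S" using inj by (simp add: bij_betw_def)
  thus ?thesis using x0(1) by (rule bexI)
qed

section \<open>Polynomial functions modulo a prime\<close>

lemma fermat_int:
  fixes x :: int
  assumes "prime p" "\<not> int p dvd x"
  shows "[x ^ (p - 1) = 1] (mod int p)"
proof -
  define a where "a = nat (x mod int p)"
  have a: "int a = x mod int p"
    using assms(1) by (simp add: a_def prime_gt_0_nat)
  have "\<not> p dvd a"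
    using assms(2) a by (metis dvd_mod_iff dvd_refl int_dvd_int_iff)
  hence "[int a ^ (p - 1) = 1] (mod int p)"
    using fermat_theorem[OF assms(1)] by (metis cong_int_iff of_nat_1 of_nat_power)
  thus ?thesis by (simp add: a cong_def power_mod)
qed

lemma fermat_int_self:
  fixes x :: int
  assumes "prime p"
  shows "[x ^ p = x] (mod int p)"
proof (cases "int p dvd x")
  case True
  hence "int p dvd x ^ p" using assms by (simp add: dvd_trans[OF _ dvd_power] prime_gt_0_nat)
  thus ?thesis using True by (simp add: cong_iff_dvd_diff)
next
  case False
  have "[x * x ^ (p - 1) = x * 1] (mod int p)"
    by (intro cong_mult cong_refl fermat_int assms False)
  thus ?thesis using assms by (simp add: power_eq_if prime_gt_0_nat)
qed

text \<open>By Fermat, \<open>1 - (x - a)\<^bsup>p - 1\<^esup>\<close> is the indicator function of \<open>a\<close> mod \<open>p\<close>.\<close>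

lemma interpolation_mod_prime:
  assumes "prime p"
  shows "\<exists>f. \<forall>x\<in>Zmod (int p). [poly f x = u x] (mod int p)"
proof (intro exI ballI)
  fix x assume x: "x \<in> Zmod (int p)"
  have "[u a * (1 - (x - a) ^ (p - 1)) = (if a = x then u a else 0)] (mod int p)"
    if a: "a \<in> Zmod (int p)" for a
  proof (cases "a = x")
    case True
    thus ?thesis using prime_gt_1_nat[OF assms] by (simp add: zero_power)
  next
    case False
    have "\<not> int p dvd x - a"
    proof
      assume "int p dvd x - a"
      hence "[x = a] (mod int p)" by (simp add: cong_iff_dvd_diff)
      thus False using x a False by (simp add: cong_def Zmod_eq)
    qed
    hence "[u a * (1 - (x - a) ^ (p - 1)) = u a * (1 - 1)] (mod int p)"
      by (intro cong_mult cong_diff cong_refl fermat_int assms)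
    thus ?thesis using False by simp
  qed
  hence "[(\<Sum>a\<in>Zmod (int p). u a * (1 - (x - a) ^ (p - 1))) =
         (\<Sum>a\<in>Zmod (int p). if a = x then u a else 0)] (mod int p)"
    by (intro cong_sum)
  moreover have "(\<Sum>a\<in>Zmod (int p). if a = x then u a else 0) = u x"
    using x by (simp add: Zmod_eq)
  ultimately show "[poly (\<Sum>a\<in>Zmod (int p). smult (u a) (1 - [:-a, 1:] ^ (p - 1))) x = u x] (mod int p)"
    by (simp add: poly_sum poly_power)
qed

text \<open>The polynomial \<open>x\<^sup>p - x\<close> vanishes as a function mod \<open>p\<close> but has derivative \<open>-1\<close>. Adding
  \<open>(x\<^sup>p - x) g\<close> therefore keeps the values and changes the derivative by \<open>-g\<close>, where \<open>g\<close> is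
  arbitrary.\<close>

lemma hermite_interpolation_mod_prime:
  assumes "prime p"
  shows "\<exists>f. \<forall>x\<in>Zmod (int p). [poly f x = s x] (mod int p) \<and> [poly (pderiv f) x = u x] (mod int p)"
proof -
  obtain f where f: "\<And>x. x \<in> Zmod (int p) \<Longrightarrow> [poly f x = s x] (mod int p)"
    using interpolation_mod_prime[OF assms] by blast
  obtain g where g: "\<And>x. x \<in> Zmod (int p) \<Longrightarrow> [poly g x = poly (pderiv f) x - u x] (mod int p)"
    using interpolation_mod_prime[OF assms, of "\<lambda>x. poly (pderiv f) x - u x"] by blast
  define h where "h = f + (monom 1 p - [:0, 1:]) * g"
  have z: "[x ^ p - x = 0] (mod int p)" for x
    using cong_diff[OF fermat_int_self[OF assms, of x] cong_refl[of x]] by simp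
  have "[poly h x = s x] (mod int p) \<and> [poly (pderiv h) x = u x] (mod int p)"
    if x: "x \<in> Zmod (int p)" for x
  proof
    have "[poly f x + (x ^ p - x) * poly g x = s x + 0 * poly g x] (mod int p)"
      by (intro cong_add cong_mult cong_refl z f x)
    thus "[poly h x = s x] (mod int p)" by (simp add: h_def poly_monom)
    have "[poly (pderiv f) x + ((x ^ p - x) * poly (pderiv g) x + poly g x * (int p * x ^ (p - 1) - 1)) =
           poly (pderiv f) x + (0 * poly (pderiv g) x + (poly (pderiv f) x - u x) * (0 * x ^ (p - 1) - 1))] (mod int p)"
      by (intro cong_add cong_mult cong_diff cong_refl z g x) (simp add: cong_def)
    thus "[poly (pderiv h) x = u x] (mod int p)"
      by (simp add: h_def pderiv_add pderiv_mult pderiv_diff pderiv_monom poly_monom pderiv_pCons)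
  qed
  thus ?thesis by blast
qed

lemma induced_eq_iff:
  assumes "k > 0"
  shows "induced k f = induced k g \<longleftrightarrow> (\<forall>x. [poly f x = poly g x] (mod k))"
proof
  assume eq: "induced k f = induced k g"
  show "\<forall>x. [poly f x = poly g x] (mod k)"
  proof
    fix x
    have "x mod k \<in> Zmod k" using assms by (simp add: Zmod_eq)
    with fun_cong[OF eq, of "x mod k"] show "[poly f x = poly g x] (mod k)"
      by (simp add: induced_def cong_def poly_mod_arg)
  qed
qed (simp add: induced_def cong_def)

lemma induced_Bij_iff:
  assumes "k > 0"
  shows "induced k f \<in> Bij (Zmod k) \<longleftrightarrow> (\<forall>x y. [poly f x = poly f y] (mod k) \<longrightarrow> [x = y] (mod k))"
proof
  assume "induced k f \<in> Bij (Zmod k)"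
  hence inj: "inj_on (induced k f) (Zmod k)" by (simp add: Bij_def bij_betw_def)
  have "[x = y] (mod k)" if "[poly f x = poly f y] (mod k)" for x y
  proof -
    have "x mod k \<in> Zmod k" "y mod k \<in> Zmod k" using assms by (simp_all add: Zmod_eq)
    moreover from this have "induced k f (x mod k) = induced k f (y mod k)"
      using that unfolding cong_def by (simp add: induced_def poly_mod_arg)
    ultimately show ?thesis using inj unfolding cong_def by (blast dest: inj_onD)
  qed
  thus "\<forall>x y. [poly f x = poly f y] (mod k) \<longrightarrow> [x = y] (mod k)" by blast
next
  assume *: "\<forall>x y. [poly f x = poly f y] (mod k) \<longrightarrow> [x = y] (mod k)"
  have inj: "inj_on (induced k f) (Zmod k)"
  proof (rule inj_onI)
    fix x y assume xy: "x \<in> Zmod k" "y \<in> Zmod k" "induced k f x = induced k f y"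
    have "[poly f x = poly f y] (mod k)" using xy by (simp add: induced_def cong_def)
    hence "[x = y] (mod k)" using * by blast
    thus "x = y" using xy by (simp add: cong_def Zmod_eq)
  qed
  have "induced k f ` Zmod k \<subseteq> Zmod k" using assms by (auto simp: induced_def Zmod_eq)
  hence "induced k f ` Zmod k = Zmod k"
    using inj by (intro endo_inj_surj) (simp_all add: Zmod_eq)
  thus "induced k f \<in> Bij (Zmod k)" using inj by (simp add: Bij_def bij_betw_def induced_def)
qed

section \<open>Lifting permutations from a prime to its powers\<close>

locale prime_power_modulus =
  fixes p n :: nat
  assumes prime_p: "prime p" and n_ge_2: "n \<ge> 2"
begin

abbreviation q :: int where "q \<equiv> int p"
abbreviation m :: int where "m \<equiv> int p ^ n"
abbreviation G :: "(int \<Rightarrow> int) monoid" where "G \<equiv> poly_perm_group m"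

lemma q_gt_1: "q > 1" using prime_gt_1_nat[OF prime_p] by simp
lemma m_gt_0: "m > 0" using q_gt_1 by simp
lemma prime_q: "prime q" using prime_p by simp
lemma q_dvd_m: "q dvd m" using n_ge_2 by (simp add: dvd_power)
lemma q2_dvd_m: "q\<^sup>2 dvd m" using n_ge_2 by (rule le_imp_power_dvd)
lemma q2_le_m: "q\<^sup>2 \<le> m" using q2_dvd_m m_gt_0 by (rule zdvd_imp_le)
lemma two_q_le_m: "2 * q \<le> m"
proof -
  have "2 * q \<le> q * q" using q_gt_1 by (intro mult_right_mono) auto
  thus ?thesis using q2_le_m by (simp add: power2_eq_square)
qed

text \<open>If \<open>x = y + p\<^sup>k t\<close>, then \<open>f(x) - f(y) \<equiv> p\<^sup>k t f'(y)\<close> modulo \<open>p\<^bsup>k + 1\<^esup>\<close>, and as \<open>p\<close> does not divide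
  \<open>f'(y)\<close>, agreement of the values modulo \<open>p\<^bsup>k + 1\<^esup>\<close> forces \<open>p\<close> to divide \<open>t\<close>. So injectivity climbs
  from each power of \<open>p\<close> to the next.\<close>

lemma hensel_step:
  assumes inj: "\<And>x y. [poly f x = poly f y] (mod q) \<Longrightarrow> [x = y] (mod q)"
    and nz: "\<And>x. \<not> q dvd poly (pderiv f) x"
    and "k \<ge> 1" "[poly f x = poly f y] (mod q ^ k)"
  shows "[x = y] (mod q ^ k)"
  using assms(3,4)
proof (induction k arbitrary: x y rule: dec_induct)
  case base
  thus ?case using inj by simp
next
  case (step k)
  have "[poly f x = poly f y] (mod q ^ k)"
    using step.prems by (rule cong_dvd_modulus) (simp add: le_imp_power_dvd)
  hence "[x = y] (mod q ^ k)" by (rule step.IH)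
  then obtain t where t: "x = y + q ^ k * t"
    by (metis cong_iff_dvd_diff dvdE add.commute diff_add_cancel)
  have "q ^ Suc k dvd (q ^ k * t)\<^sup>2"
  proof -
    have "q ^ Suc k dvd (q ^ k)\<^sup>2"
      using step.hyps by (simp only: power_mult[symmetric]) (rule le_imp_power_dvd, simp)
    thus ?thesis by (simp add: power_mult_distrib)
  qed
  hence "[poly f x = poly f y + q ^ k * t * poly (pderiv f) y] (mod q ^ Suc k)"
    unfolding t using poly_add_mult_cong cong_dvd_modulus by blast
  from cong_trans[OF cong_sym[OF this] step.prems]
  have "[poly f y + q ^ k * t * poly (pderiv f) y = poly f y] (mod q ^ Suc k)" .
  hence "q ^ Suc k dvd q ^ k * (t * poly (pderiv f) y)"
    by (simp add: cong_iff_dvd_diff mult.assoc)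
  hence "q dvd t * poly (pderiv f) y"
    using q_gt_1 by (simp add: mult.commute[of q])
  hence "q dvd t" using nz prime_q by (simp add: prime_dvd_mult_iff)
  thus ?case unfolding t cong_iff_dvd_diff by (simp add: mult.commute[of q] mult_dvd_mono)
qed

text \<open>Sufficiency is the preceding lifting of injectivity. For necessity of the derivative
  condition, note that at a zero \<open>x\<close> of \<open>f'\<close> mod \<open>p\<close> the values at \<open>x\<close> and \<open>x + p\<^bsup>n - 1\<^esup>\<close> agree
  modulo \<open>p\<^sup>n\<close>; this is where \<open>n \<ge> 2\<close> enters.\<close>

lemma induced_Bij_prime_power_iff:
  "induced m f \<in> Bij (Zmod m) \<longleftrightarrow>
     induced q f \<in> Bij (Zmod q) \<and> (\<forall>x\<in>Zmod q. induced q (pderiv f) x \<noteq> 0)"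
proof
  assume R: "induced q f \<in> Bij (Zmod q) \<and> (\<forall>x\<in>Zmod q. induced q (pderiv f) x \<noteq> 0)"
  have "\<not> q dvd poly (pderiv f) x" for x
  proof -
    have "x mod q \<in> Zmod q" using q_gt_1 by (simp add: Zmod_eq)
    with R have "induced q (pderiv f) (x mod q) \<noteq> 0" by blast
    thus ?thesis using \<open>x mod q \<in> Zmod q\<close> by (simp add: induced_def poly_mod_arg dvd_eq_mod_eq_0)
  qed
  moreover have "[x = y] (mod q)" if "[poly f x = poly f y] (mod q)" for x y
    using R that induced_Bij_iff[of q f] q_gt_1 by simp
  ultimately have "[x = y] (mod m)" if "[poly f x = poly f y] (mod m)" for x y
    using hensel_step[of f n x y] that n_ge_2 by simp
  thus "induced m f \<in> Bij (Zmod m)"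
    unfolding induced_Bij_iff[OF m_gt_0] by blast
next
  assume L: "induced m f \<in> Bij (Zmod m)"
  have inj: "[x = y] (mod m)" if "[poly f x = poly f y] (mod m)" for x y
    using L that unfolding induced_Bij_iff[OF m_gt_0] by blast
  have surj: "induced m f ` Zmod m = Zmod m" using L by (simp add: Bij_def bij_betw_def)
  have "Zmod q \<subseteq> induced q f ` Zmod q"
  proof
    fix y assume y: "y \<in> Zmod q"
    hence "y \<in> Zmod m" using two_q_le_m by (simp add: Zmod_eq)
    then obtain x where x: "y = poly f x mod m" using surj by (auto simp: induced_def)
    have "y = y mod q" using y by (simp add: Zmod_eq)
    also have "\<dots> = poly f x mod q" using x q_dvd_m by (simp add: mod_mod_cancel)
    finally have "y = induced q f (x mod q)"
      using q_gt_1 by (simp add: induced_def Zmod_eq poly_mod_arg)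
    thus "y \<in> induced q f ` Zmod q" using q_gt_1 by (simp add: Zmod_eq)
  qed
  moreover have "induced q f ` Zmod q \<subseteq> Zmod q" using q_gt_1 by (auto simp: induced_def Zmod_eq)
  moreover have "finite (Zmod q)" by (simp add: Zmod_eq)
  ultimately have "bij_betw (induced q f) (Zmod q) (Zmod q)"
    by (auto simp: bij_betw_def intro: finite_surj_inj)
  moreover have "induced q (pderiv f) x \<noteq> 0" if x: "x \<in> Zmod q" for x
  proof
    assume "induced q (pderiv f) x = 0"
    hence d: "q dvd poly (pderiv f) x" using x by (simp add: induced_def mod_eq_0_iff_dvd)
    \<comment> \<open>Nonzero modulo \<open>p\<^sup>n\<close>, although \<open>h\<^sup>2\<close> and \<open>p h\<close> vanish there.\<close>
    define h where "h = q ^ (n - 1)"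
    have m: "m = h * q" unfolding h_def using n_ge_2 by (simp flip: power_Suc2)
    have "m dvd h\<^sup>2" unfolding h_def power_mult[symmetric] using n_ge_2 by (intro le_imp_power_dvd) simp
    hence "[poly f (x + h) = poly f x + h * poly (pderiv f) x] (mod m)"
      using poly_add_mult_cong cong_dvd_modulus by blast
    moreover have "[poly f x + h * poly (pderiv f) x = poly f x] (mod m)"
      using d m by (simp add: cong_iff_dvd_diff)
    ultimately have "[x + h = x] (mod m)" by (metis cong_trans inj)
    hence "h * q dvd h" by (simp add: cong_iff_dvd_diff m)
    moreover have "h > 0" using q_gt_1 by (simp add: h_def)
    ultimately show False using q_gt_1 zdvd_imp_le[of "h * q" h] by simp
  qed
  ultimately show "induced q f \<in> Bij (Zmod q) \<and> (\<forall>x\<in>Zmod q. induced q (pderiv f) x \<noteq> 0)"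
    by (simp add: Bij_def induced_def)
qed

section \<open>Reduction and derivative of a polynomial permutation\<close>

text \<open>The maps \<open>red\<close> and \<open>der\<close> are defined on functions rather than on polynomials, so that they are
  well defined on \<open>G\<close> by construction. The derivative mod \<open>p\<close> is recovered as the difference
  quotient with step \<open>p\<close>, since \<open>f(x + p) \<equiv> f(x) + p f'(x)\<close> modulo \<open>p\<^sup>2\<close>.\<close>

definition red :: "(int \<Rightarrow> int) \<Rightarrow> int \<Rightarrow> int" where
  "red F = (\<lambda>x\<in>Zmod q. F x mod q)"

definition der :: "(int \<Rightarrow> int) \<Rightarrow> int \<Rightarrow> int" where
  "der F = (\<lambda>x\<in>Zmod q. (F (x + q) - F x) div q mod q)"

lemma red_induced [simp]: "red (induced m f) = induced q f"
  using two_q_le_m q_dvd_m q_gt_1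
  by (auto simp: red_def induced_def Zmod_eq mod_mod_cancel fun_eq_iff)

lemma der_induced [simp]: "der (induced m f) = induced q (pderiv f)"
proof -
  have "(induced m f (x + q) - induced m f x) div q mod q = poly (pderiv f) x mod q"
    if x: "x \<in> Zmod q" for x
  proof -
    have x': "x \<in> Zmod m" "x + q \<in> Zmod m" using x two_q_le_m by (auto simp: Zmod_eq)
    have "[induced m f (x + q) - induced m f x = poly f (x + q) - poly f x] (mod m)"
      using x' by (intro cong_diff) (simp_all add: induced_def cong_def)
    hence "[induced m f (x + q) - induced m f x = poly f (x + q) - poly f x] (mod q\<^sup>2)"
      using q2_dvd_m by (rule cong_dvd_modulus)
    moreover have "[poly f (x + q) - poly f x = q * poly (pderiv f) x] (mod q\<^sup>2)"
      using cong_diff[OF poly_add_mult_cong[of f x q] cong_refl[of "poly f x"]] by simp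
    ultimately have "[induced m f (x + q) - induced m f x = q * poly (pderiv f) x] (mod q\<^sup>2)"
      by (rule cong_trans)
    \<comment> \<open>The error of the difference quotient is \<open>p t\<close>, which disappears mod \<open>p\<close>.\<close>
    then obtain t where "induced m f (x + q) - induced m f x - q * poly (pderiv f) x = q\<^sup>2 * t"
      unfolding cong_iff_dvd_diff by (elim dvdE)
    hence "induced m f (x + q) - induced m f x = q * (poly (pderiv f) x + q * t)"
      by (simp add: algebra_simps power2_eq_square)
    thus ?thesis using q_gt_1 by simp
  qed
  thus ?thesis by (auto simp: der_def fun_eq_iff induced_def[of q])
qed

lemma carrier_G: "carrier G = Bij (Zmod m) \<inter> range (induced m)"
  by (simp add: poly_perm_group_def)

lemma mult_G: "F \<in> carrier G \<Longrightarrow> H \<in> carrier G \<Longrightarrow> F \<otimes>\<^bsub>G\<^esub> H = compose (Zmod m) F H"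
  by (simp add: poly_perm_group_def BijGroup_def)

lemma group_G: "group G"
  using m_gt_0 by (rule group_poly_perm_group)

lemma finite_G: "finite (carrier G)"
  unfolding carrier_G using finite_Bij_Zmod by simp

lemma nonzero_funs_iff:
  "u \<in> nonzero_funs q \<longleftrightarrow>
     u \<in> extensional (Zmod q) \<and> (\<forall>x\<in>Zmod q. u x \<in> Zmod q \<and> \<not> q dvd u x)"
proof -
  have "y \<in> Zmod q - {\<zero>\<^bsub>residue_ring q\<^esub>} \<longleftrightarrow> y \<in> Zmod q \<and> \<not> q dvd y" for y
    by (auto simp: residue_ring_def dvd_imp_mod_0 zdvd_not_zless)
  thus ?thesis unfolding nonzero_funs_def PiE_iff by blast
qed

lemma induced_mem_G_iff:
  "induced m f \<in> carrier G \<longleftrightarrow>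
     induced q f \<in> Bij (Zmod q) \<and> induced q (pderiv f) \<in> nonzero_funs q"
proof -
  have "induced q (pderiv f) \<in> nonzero_funs q \<longleftrightarrow> (\<forall>x\<in>Zmod q. induced q (pderiv f) x \<noteq> 0)"
    unfolding nonzero_funs_iff using q_gt_1
    by (auto simp: induced_def dvd_eq_mod_eq_0 Zmod_eq)
  thus ?thesis by (simp add: carrier_G induced_Bij_prime_power_iff)
qed

lemma G_cases:
  assumes "F \<in> carrier G"
  obtains f where "F = induced m f"
  using assms unfolding carrier_G by blast

lemma red_Bij: "F \<in> carrier G \<Longrightarrow> red F \<in> Bij (Zmod q)"
  by (metis G_cases induced_mem_G_iff red_induced)

lemma der_nonzero: "F \<in> carrier G \<Longrightarrow> der F \<in> nonzero_funs q"
  by (metis G_cases induced_mem_G_iff der_induced)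

lemma red_mult:
  assumes "F \<in> carrier G" "H \<in> carrier G"
  shows "red (F \<otimes>\<^bsub>G\<^esub> H) = red F \<otimes>\<^bsub>BijGroup (Zmod q)\<^esub> red H"
proof -
  obtain f h where fh: "F = induced m f" "H = induced m h" using assms by (metis G_cases)
  have "red F \<otimes>\<^bsub>BijGroup (Zmod q)\<^esub> red H = compose (Zmod q) (red F) (red H)"
    using assms red_Bij by (simp add: BijGroup_def)
  thus ?thesis using assms m_gt_0 q_gt_1
    by (simp add: mult_G fh induced_pcompose del: of_nat_power)
qed

lemma red_hom: "group_hom G (BijGroup (Zmod q)) red"
  unfolding group_hom_def group_hom_axioms_def
  using group_G group_BijGroup red_Bij red_mult by (auto simp: hom_def carrier_BijGroup)

text \<open>The chain rule makes \<open>der\<close> a cocycle over the homomorphism \<open>red\<close>.\<close>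

lemma der_mult:
  assumes "F \<in> carrier G" "H \<in> carrier G" "x \<in> Zmod q"
  shows "[der (F \<otimes>\<^bsub>G\<^esub> H) x = der F (red H x) * der H x] (mod q)"
proof -
  obtain f h where fh: "F = induced m f" "H = induced m h" using assms by (metis G_cases)
  have hx: "poly h x mod q \<in> Zmod q" using q_gt_1 by (simp add: Zmod_eq)
  have "F \<otimes>\<^bsub>G\<^esub> H = induced m (pcompose f h)"
    using assms m_gt_0 by (simp add: mult_G fh induced_pcompose)
  hence "der (F \<otimes>\<^bsub>G\<^esub> H) x = induced q (pderiv (pcompose f h)) x" by simp
  also have "\<dots> = poly (pderiv (pcompose f h)) x mod q"
    using assms(3) by (simp add: induced_def)
  also have "[poly (pderiv (pcompose f h)) x mod q = poly (pderiv f) (poly h x) * poly (pderiv h) x] (mod q)"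
    by (simp add: pderiv_pcompose poly_pcompose cong_def)
  also have "[poly (pderiv f) (poly h x) * poly (pderiv h) x =
      poly (pderiv f) (poly h x mod q) mod q * (poly (pderiv h) x mod q)] (mod q)"
    by (intro cong_mult) (simp_all add: cong_def poly_mod_arg)
  also have "poly (pderiv f) (poly h x mod q) mod q * (poly (pderiv h) x mod q) =
      der F (red H x) * der H x"
    unfolding fh der_induced red_induced using assms(3) hx by (simp add: induced_def)
  finally show ?thesis .
qed

section \<open>The order of the group of polynomial permutations\<close>

text \<open>The functions by which two elements of \<open>G\<close> with equal \<open>red\<close> and equal \<open>der\<close> can differ.\<close>

definition flat :: "(int \<Rightarrow> int) set" where
  "flat = {induced m g | g. induced q g = induced q 0 \<and> induced q (pderiv g) = induced q 0}"

text \<open>These functions form a subgroup of the additive group of all functions on \<open>\<int>/p\<^sup>n\<close>, whose order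
  is \<open>(p\<^sup>n)\<^bsup>p\<^sup>n\<^esup>\<close>.\<close>

lemma card_flat: "\<exists>k. card flat = p ^ k"
proof -
  let ?R = "residue_ring m"
  interpret R: residues m ?R using two_q_le_m q_gt_1 by unfold_locales auto
  let ?P = "product_group (Zmod m) (\<lambda>_. add_monoid ?R)"
  have grp: "group (add_monoid ?R)" by (rule R.a_group)
  interpret P: group ?P using grp by (intro product_group)
  have car: "induced m g \<in> carrier ?P" for g
    using m_gt_0 by (auto simp: induced_def Zmod_eq[of m])
  have "subgroup flat ?P"
  proof (rule P.subgroupI)
    show "flat \<subseteq> carrier ?P" unfolding flat_def using car by blast
    have "induced m 0 \<in> flat" unfolding flat_def by (intro CollectI exI[of _ 0]) simp
    thus "flat \<noteq> {}" by blast
  next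
    fix F assume "F \<in> flat"
    then obtain g where g: "F = induced m g" "induced q g = induced q 0" "induced q (pderiv g) = induced q 0"
      unfolding flat_def by blast
    have "inv\<^bsub>?P\<^esub> F = (\<lambda>x\<in>Zmod m. inv\<^bsub>add_monoid ?R\<^esub> (F x))"
      using car[of g] grp unfolding g(1) by (intro inv_product_group) simp_all
    also have "\<dots> = (\<lambda>x\<in>Zmod m. (- F x) mod m)"
      unfolding a_inv_def[symmetric] R.res_neg_eq ..
    also have "\<dots> = induced m (- g)"
      by (auto simp: fun_eq_iff induced_def g(1) mod_minus_eq)
    finally have "inv\<^bsub>?P\<^esub> F = induced m (- g)" .
    moreover have "induced m (- g) \<in> flat" unfolding flat_def
    proof (intro CollectI exI[of _ "- g"] conjI refl)
      show "induced q (- g) = induced q 0" "induced q (pderiv (- g)) = induced q 0"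
        using g q_gt_1 by (simp_all add: induced_eq_iff pderiv_minus cong_0_iff)
    qed
    ultimately show "inv\<^bsub>?P\<^esub> F \<in> flat" by simp
  next
    fix F H assume "F \<in> flat" "H \<in> flat"
    then obtain g h where g: "F = induced m g" "induced q g = induced q 0" "induced q (pderiv g) = induced q 0"
      and h: "H = induced m h" "induced q h = induced q 0" "induced q (pderiv h) = induced q 0"
      unfolding flat_def by blast
    have "F \<otimes>\<^bsub>?P\<^esub> H = induced m (g + h)"
      using R.res_add_eq by (auto simp: fun_eq_iff induced_def g(1) h(1) mod_add_eq)
    moreover have "induced m (g + h) \<in> flat" unfolding flat_def
    proof (intro CollectI exI[of _ "g + h"] conjI refl)
      show "induced q (g + h) = induced q 0" "induced q (pderiv (g + h)) = induced q 0"
        using g h q_gt_1 by (simp_all add: induced_eq_iff pderiv_add cong_0_iff)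
    qed
    ultimately show "F \<otimes>\<^bsub>?P\<^esub> H \<in> flat" by simp
  qed
  from P.lagrange[OF this] have "card flat dvd Coset.order ?P" by (metis dvd_triv_right)
  also have "Coset.order ?P = (p ^ n) ^ (p ^ n)"
    by (simp add: Coset.order_def card_PiE Zmod_eq)
       (simp add: nat_power_eq)
  finally show ?thesis
    using prime_p by (auto simp: divides_primepow_nat simp flip: power_mult)
qed

definition fibre :: "(int \<Rightarrow> int) \<Rightarrow> (int \<Rightarrow> int) \<Rightarrow> (int \<Rightarrow> int) set" where
  "fibre \<sigma> u = {F \<in> carrier G. red F = \<sigma> \<and> der F = u}"

lemma induced_eqI:
  assumes "\<sigma> \<in> extensional (Zmod q)" "\<And>x. x \<in> Zmod q \<Longrightarrow> \<sigma> x \<in> Zmod q \<and> [poly f x = \<sigma> x] (mod q)"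
  shows "induced q f = \<sigma>"
proof (rule extensionalityI[of _ "Zmod q"])
  fix x assume "x \<in> Zmod q"
  thus "induced q f x = \<sigma> x" using assms(2)[of x] by (simp add: induced_def cong_def Zmod_eq)
qed (simp_all add: induced_def assms)

text \<open>Hermite interpolation gives one polynomial \<open>f0\<close> with the prescribed reduction and derivative;
  it induces a permutation by Hensel's argument, and so does every other polynomial with these
  data. Translation by \<open>f0\<close> then identifies the fibre with \<open>flat\<close>.\<close>

lemma card_fibre:
  assumes \<sigma>: "\<sigma> \<in> Bij (Zmod q)" and u: "u \<in> nonzero_funs q"
  shows "card (fibre \<sigma> u) = card flat"
proof -
  obtain f0 where f0: "\<And>x. x \<in> Zmod q \<Longrightarrow> [poly f0 x = \<sigma> x] (mod q) \<and> [poly (pderiv f0) x = u x] (mod q)"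
    using hermite_interpolation_mod_prime[OF prime_p] by blast
  have "\<sigma> \<in> Zmod q \<rightarrow> Zmod q" "\<sigma> \<in> extensional (Zmod q)"
    using \<sigma> by (simp_all add: Bij_imp_funcset Bij_imp_extensional)
  hence s0: "induced q f0 = \<sigma>" using f0 by (intro induced_eqI) auto
  have u0: "induced q (pderiv f0) = u" using u f0 by (intro induced_eqI) (auto simp: nonzero_funs_iff)
  let ?t = "\<lambda>H. \<lambda>x\<in>Zmod m. (H x + poly f0 x) mod m"
  let ?t' = "\<lambda>H. \<lambda>x\<in>Zmod m. (H x - poly f0 x) mod m"
  \<comment> \<open>On functions induced by polynomials, the two maps are addition and subtraction of \<open>f0\<close>.\<close>
  have t: "?t (induced m g) = induced m (g + f0)" for g
    by (auto simp: induced_def fun_eq_iff mod_add_left_eq)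
  have t': "?t' (induced m g) = induced m (g - f0)" for g
    by (auto simp: induced_def fun_eq_iff mod_diff_left_eq)
  have "bij_betw ?t flat (fibre \<sigma> u)"
  proof (rule bij_betw_byWitness[where f' = ?t'])
    have "?t' (?t (induced m g)) = induced m g" "?t (?t' (induced m g)) = induced m g" for g
      unfolding t t' by simp_all
    moreover have "F \<in> range (induced m)" if "F \<in> flat \<union> fibre \<sigma> u" for F
      using that unfolding flat_def fibre_def carrier_G by blast
    ultimately show "\<forall>F\<in>flat. ?t' (?t F) = F" "\<forall>F\<in>fibre \<sigma> u. ?t (?t' F) = F"
      by blast+
    show "?t ` flat \<subseteq> fibre \<sigma> u"
    proof clarify
      fix F assume "F \<in> flat"
      then obtain g where g: "F = induced m g" "induced q g = induced q 0" "induced q (pderiv g) = induced q 0"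
        unfolding flat_def by blast
      have "induced q (g + f0) = induced q f0" "induced q (pderiv (g + f0)) = induced q (pderiv f0)"
        using g(2,3) q_gt_1 by (simp_all add: induced_eq_iff pderiv_add cong_iff_dvd_diff)
      hence "induced m (g + f0) \<in> fibre \<sigma> u"
        using \<sigma> u s0 u0 by (simp add: fibre_def induced_mem_G_iff)
      thus "?t F \<in> fibre \<sigma> u" unfolding g(1) t .
    qed
    show "?t' ` fibre \<sigma> u \<subseteq> flat"
    proof clarify
      fix F assume F: "F \<in> fibre \<sigma> u"
      then obtain f where f: "F = induced m f" unfolding fibre_def by (blast elim: G_cases)
      have "induced q f = induced q f0" "induced q (pderiv f) = induced q (pderiv f0)"
        using F s0 u0 by (simp_all add: fibre_def f)
      hence "induced q (f - f0) = induced q 0" "induced q (pderiv (f - f0)) = induced q 0"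
        using q_gt_1 by (simp_all add: induced_eq_iff pderiv_diff cong_iff_dvd_diff)
      hence "induced m (f - f0) \<in> flat" unfolding flat_def by blast
      thus "?t' F \<in> flat" unfolding f t' .
    qed
  qed
  thus ?thesis by (rule bij_betw_same_card[symmetric])
qed

lemma card_Bij_Zmod: "card (Bij (Zmod q)) = fact p"
  using card_Bij[of "Zmod q"] by (simp add: Zmod_eq)

lemma order_G: "Coset.order G = fact p * (p - 1) ^ p * card flat"
proof -
  let ?B = "Bij (Zmod q) \<times> nonzero_funs q"
  have z: "\<zero>\<^bsub>residue_ring q\<^esub> \<in> Zmod q" using q_gt_1 by (simp add: residue_ring_def)
  have fin: "finite (nonzero_funs q)"
    unfolding nonzero_funs_def by (intro finite_PiE) (simp_all add: Zmod_eq)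
  have card: "card (nonzero_funs q) = (p - 1) ^ p"
    unfolding nonzero_funs_def using z by (simp add: card_PiE card_Diff_singleton Zmod_eq)
  have "card (carrier G) = card ?B * card flat"
  proof (rule card_eq_card_times_fibre[where f = "\<lambda>F. (red F, der F)"])
    show "(\<lambda>F. (red F, der F)) ` carrier G \<subseteq> ?B" using red_Bij der_nonzero by blast
    fix b assume "b \<in> ?B"
    thus "card {F \<in> carrier G. (red F, der F) = b} = card flat"
      using card_fibre[of "fst b" "snd b"] by (cases b) (simp add: fibre_def)
  qed (simp_all add: finite_G finite_Bij_Zmod fin)
  thus ?thesis by (simp add: Coset.order_def card_cartesian_product card_Bij_Zmod card)
qed

text \<open>In \<open>p! (p - 1)\<^sup>p |flat|\<close> only one factor \<open>p\<close> lies outside the \<open>p\<close>-power \<open>|flat|\<close>.\<close>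

lemma sylow_order: "p ^ multiplicity p (Coset.order G) = p * card flat"
proof -
  obtain k where k: "card flat = p ^ k" using card_flat by blast
  have "fact p = p * fact (p - 1)"
    using fact_reduce[of p, where ?'a = nat] prime_gt_0_nat[OF prime_p] by simp
  hence "Coset.order G = p ^ Suc k * (fact (p - 1) * (p - 1) ^ p)"
    by (simp only: order_G k power_Suc ac_simps)
  moreover have "\<not> p dvd fact (p - 1) * (p - 1) ^ p"
  proof -
    have "\<not> p dvd p - 1" using prime_gt_1_nat[OF prime_p] by (auto dest: dvd_imp_le)
    moreover have "\<not> p dvd fact (p - 1)"
      using prime_dvd_fact_iff[OF prime_p, of "p - 1"] prime_gt_1_nat[OF prime_p] by simp
    ultimately show ?thesis using prime_p by (simp add: prime_dvd_mult_iff prime_dvd_power_iff prime_gt_0_nat)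
  qed
  moreover have "p \<noteq> 0" using prime_gt_0_nat[OF prime_p] by simp
  ultimately have "multiplicity p (Coset.order G) = Suc k"
    using prime_gt_1_nat[OF prime_p] by (intro multiplicity_decomposeI) auto
  thus ?thesis by (simp add: k)
qed

section \<open>The subgroup attached to a cyclic group and a function\<close>

abbreviation R :: "int ring" where "R \<equiv> residue_ring q"

text \<open>The coboundary of \<open>\<phi>\<close>: the derivative that an element with reduction \<open>\<sigma>\<close> must have in order to
  lie in the subgroup attached to \<open>\<phi>\<close>.\<close>

definition ratio :: "(int \<Rightarrow> int) \<Rightarrow> (int \<Rightarrow> int) \<Rightarrow> int \<Rightarrow> int" where
  "ratio \<phi> \<sigma> = (\<lambda>x\<in>Zmod q. \<phi> (\<sigma> x) \<otimes>\<^bsub>R\<^esub> inv\<^bsub>R\<^esub> (\<phi> x))"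

lemma mod_quotient_iff:
  assumes "a \<in> Zmod q" "b \<in> Zmod q" "c \<in> Zmod q" "\<not> q dvd b"
  shows "a = c \<otimes>\<^bsub>R\<^esub> inv\<^bsub>R\<^esub> b \<longleftrightarrow> [a * b = c] (mod q)"
proof -
  interpret residues_prime p R using prime_p by unfold_locales auto
  have "b \<noteq> \<zero>\<^bsub>R\<^esub>" using assms(4) by (auto simp: residue_ring_def)
  hence b: "b \<in> Units R" using assms(2) field_Units by blast
  have "a = c \<otimes>\<^bsub>R\<^esub> inv\<^bsub>R\<^esub> b \<longleftrightarrow> a \<otimes>\<^bsub>R\<^esub> b = c"
  proof
    assume "a = c \<otimes>\<^bsub>R\<^esub> inv\<^bsub>R\<^esub> b"
    thus "a \<otimes>\<^bsub>R\<^esub> b = c" using assms b by (simp add: m_assoc)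
  next
    assume "a \<otimes>\<^bsub>R\<^esub> b = c"
    hence "c \<otimes>\<^bsub>R\<^esub> inv\<^bsub>R\<^esub> b = a \<otimes>\<^bsub>R\<^esub> b \<otimes>\<^bsub>R\<^esub> inv\<^bsub>R\<^esub> b" by simp
    also have "\<dots> = a \<otimes>\<^bsub>R\<^esub> (b \<otimes>\<^bsub>R\<^esub> inv\<^bsub>R\<^esub> b)"
      using assms b by (intro m_assoc) auto
    finally have "c \<otimes>\<^bsub>R\<^esub> inv\<^bsub>R\<^esub> b = a \<otimes>\<^bsub>R\<^esub> (b \<otimes>\<^bsub>R\<^esub> inv\<^bsub>R\<^esub> b)" .
    thus "a = c \<otimes>\<^bsub>R\<^esub> inv\<^bsub>R\<^esub> b" using assms b by simp
  qed
  also have "a \<otimes>\<^bsub>R\<^esub> b = a * b mod q" by (rule res_mult_eq)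
  also have "a * b mod q = c \<longleftrightarrow> [a * b = c] (mod q)"
    using assms(3) by (auto simp: cong_def Zmod_eq)
  finally show ?thesis .
qed

lemma nonzero_funsD:
  assumes "\<phi> \<in> nonzero_funs q" "x \<in> Zmod q"
  shows "\<phi> x \<in> Zmod q" "\<not> q dvd \<phi> x"
  using assms unfolding nonzero_funs_iff by blast+

lemma eq_ratio_iff:
  assumes "\<phi> \<in> nonzero_funs q" "\<sigma> \<in> Bij (Zmod q)" "u \<in> nonzero_funs q"
  shows "u = ratio \<phi> \<sigma> \<longleftrightarrow> (\<forall>x\<in>Zmod q. [u x * \<phi> x = \<phi> (\<sigma> x)] (mod q))"
proof -
  have "u = ratio \<phi> \<sigma> \<longleftrightarrow> (\<forall>x\<in>Zmod q. u x = \<phi> (\<sigma> x) \<otimes>\<^bsub>R\<^esub> inv\<^bsub>R\<^esub> (\<phi> x))"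
    using assms(3) by (auto simp: ratio_def nonzero_funs_iff extensional_def fun_eq_iff)
  also have "\<dots> \<longleftrightarrow> (\<forall>x\<in>Zmod q. [u x * \<phi> x = \<phi> (\<sigma> x)] (mod q))"
  proof (intro ball_cong refl mod_quotient_iff)
    fix x assume x: "x \<in> Zmod q"
    show "u x \<in> Zmod q" "\<phi> x \<in> Zmod q" "\<not> q dvd \<phi> x" "\<phi> (\<sigma> x) \<in> Zmod q"
      using nonzero_funsD[OF assms(3) x] nonzero_funsD[OF assms(1) x]
        nonzero_funsD[OF assms(1) Bij_apply[OF assms(2) x]] by simp_all
  qed
  finally show ?thesis .
qed

lemma ratio_nonzero:
  assumes "\<phi> \<in> nonzero_funs q" "\<sigma> \<in> Bij (Zmod q)"
  shows "ratio \<phi> \<sigma> \<in> nonzero_funs q"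
proof -
  interpret residues_prime p R using prime_p by unfold_locales auto
  have u: "\<phi> x \<in> Units R" if "x \<in> Zmod q" for x
    using assms(1) that field_Units by (auto simp: nonzero_funs_def)
  have "\<phi> (\<sigma> x) \<otimes>\<^bsub>R\<^esub> inv\<^bsub>R\<^esub> (\<phi> x) \<in> Zmod q - {\<zero>\<^bsub>R\<^esub>}" if "x \<in> Zmod q" for x
    using u[OF that] u[OF Bij_apply[OF assms(2) that]] field_Units Units_m_closed Units_inv_Units
    by blast
  thus ?thesis unfolding nonzero_funs_def ratio_def by (simp only: restrict_PiE_iff) blast
qed

lemma S_subgroup_eq_ratio:
  "S_subgroup q n C \<phi> = {F \<in> carrier G. red F \<in> C \<and> der F = ratio \<phi> (red F)}"
proof -
  have "induced m f \<in> S_subgroup q n C \<phi> \<longleftrightarrow>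
      induced m f \<in> carrier G \<and> red (induced m f) \<in> C \<and>
      der (induced m f) = ratio \<phi> (red (induced m f))" for f
  proof
    assume "induced m f \<in> S_subgroup q n C \<phi>"
    then obtain g where g: "induced m f = induced m g"
      "induced m g \<in> carrier G" "induced q g \<in> C"
      "\<forall>x\<in>Zmod q. induced q (pderiv g) x = \<phi> (induced q g x) \<otimes>\<^bsub>R\<^esub> inv\<^bsub>R\<^esub> (\<phi> x)"
      unfolding S_subgroup_def by blast
    show "induced m f \<in> carrier G \<and> red (induced m f) \<in> C \<and>
      der (induced m f) = ratio \<phi> (red (induced m f))"
      unfolding g(1) red_induced der_induced
    proof (intro conjI g)
      show "induced q (pderiv g) = ratio \<phi> (induced q g)"
        using g(4) by (intro extensionalityI[of _ "Zmod q"]) (simp_all add: induced_def[of q "pderiv g"] ratio_def)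
    qed
  next
    assume a: "induced m f \<in> carrier G \<and> red (induced m f) \<in> C \<and>
      der (induced m f) = ratio \<phi> (red (induced m f))"
    hence "induced q (pderiv f) x = \<phi> (induced q f x) \<otimes>\<^bsub>R\<^esub> inv\<^bsub>R\<^esub> (\<phi> x)" if "x \<in> Zmod q" for x
      using that by (simp add: ratio_def)
    with a show "induced m f \<in> S_subgroup q n C \<phi>" unfolding S_subgroup_def red_induced by blast
  qed
  moreover have "S_subgroup q n C \<phi> \<subseteq> carrier G" unfolding S_subgroup_def by blast
  ultimately have "F \<in> S_subgroup q n C \<phi> \<longleftrightarrow> F \<in> carrier G \<and> red F \<in> C \<and> der F = ratio \<phi> (red F)" for F
    by (metis G_cases subsetD)
  thus ?thesis by blast
qed

text \<open>The form used in computations: multiplying out the quotient replaces the inverse in the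
  residue field by a congruence of integers.\<close>

lemma S_subgroup_eq:
  assumes "\<phi> \<in> nonzero_funs q"
  shows "S_subgroup q n C \<phi> =
    {F \<in> carrier G. red F \<in> C \<and> (\<forall>x\<in>Zmod q. [der F x * \<phi> x = \<phi> (red F x)] (mod q))}"
  unfolding S_subgroup_eq_ratio using eq_ratio_iff[OF assms red_Bij der_nonzero] by blast

lemma S_subgroup_fibre:
  assumes "\<sigma> \<in> C"
  shows "{F \<in> S_subgroup q n C \<phi>. red F = \<sigma>} = fibre \<sigma> (ratio \<phi> \<sigma>)"
  unfolding S_subgroup_eq_ratio fibre_def using assms by blast

lemma card_flat_pos: "card flat > 0"
  using card_flat prime_gt_0_nat[OF prime_p] by auto

lemma card_S_subgroup:
  assumes "C \<subseteq> Bij (Zmod q)" "\<phi> \<in> nonzero_funs q"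
  shows "card (S_subgroup q n C \<phi>) = card C * card flat"
proof (rule card_eq_card_times_fibre[where f = red])
  show "finite (S_subgroup q n C \<phi>)"
    using finite_G by (rule rev_finite_subset) (auto simp: S_subgroup_eq_ratio)
  show "finite C" using assms(1) finite_Bij_Zmod by (rule finite_subset)
  show "red ` S_subgroup q n C \<phi> \<subseteq> C" by (auto simp: S_subgroup_eq_ratio)
  fix \<sigma> assume \<sigma>: "\<sigma> \<in> C"
  show "card {F \<in> S_subgroup q n C \<phi>. red F = \<sigma>} = card flat"
    unfolding S_subgroup_fibre[OF \<sigma>] using \<sigma> assms by (intro card_fibre ratio_nonzero) auto
qed

lemma red_S_subgroup:
  assumes "C \<subseteq> Bij (Zmod q)" "\<phi> \<in> nonzero_funs q"
  shows "red ` S_subgroup q n C \<phi> = C"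
proof
  show "red ` S_subgroup q n C \<phi> \<subseteq> C" by (auto simp: S_subgroup_eq_ratio)
  show "C \<subseteq> red ` S_subgroup q n C \<phi>"
  proof
    fix \<sigma> assume \<sigma>: "\<sigma> \<in> C"
    hence "card (fibre \<sigma> (ratio \<phi> \<sigma>)) = card flat" using assms by (intro card_fibre ratio_nonzero) auto
    hence "fibre \<sigma> (ratio \<phi> \<sigma>) \<noteq> {}" using card_flat_pos by auto
    then obtain F where "F \<in> {F \<in> S_subgroup q n C \<phi>. red F = \<sigma>}"
      unfolding S_subgroup_fibre[OF \<sigma>] by blast
    thus "\<sigma> \<in> red ` S_subgroup q n C \<phi>" by blast
  qed
qed

lemma red_mult_apply:
  "F \<in> carrier G \<Longrightarrow> H \<in> carrier G \<Longrightarrow> x \<in> Zmod q \<Longrightarrow> red (F \<otimes>\<^bsub>G\<^esub> H) x = red F (red H x)"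
  by (simp add: red_mult BijGroup_mult_apply red_Bij)

lemma der_one: "x \<in> Zmod q \<Longrightarrow> der \<one>\<^bsub>G\<^esub> x = 1"
proof -
  assume x: "x \<in> Zmod q"
  have "\<one>\<^bsub>G\<^esub> = induced m [:0, 1:]"
    by (auto simp: poly_perm_group_def BijGroup_def induced_def Zmod_eq fun_eq_iff)
  hence "der \<one>\<^bsub>G\<^esub> = induced q (pderiv [:0, 1:])" by (simp only: der_induced)
  thus "der \<one>\<^bsub>G\<^esub> x = 1" using x q_gt_1 by (simp add: induced_def pderiv_pCons)
qed

text \<open>The condition says that \<open>der F = (\<phi> \<circ> red F) / \<phi>\<close>. Coboundaries multiply like derivatives, so
  the condition survives products and inverses by the chain rule.\<close>

lemma subgroup_S_subgroup:
  assumes C: "subgroup C (BijGroup (Zmod q))" and \<phi>: "\<phi> \<in> nonzero_funs q"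
  shows "subgroup (S_subgroup q n C \<phi>) G"
proof -
  interpret group_hom G "BijGroup (Zmod q)" red by (rule red_hom)
  show ?thesis
  proof (rule G.subgroupI)
    show "S_subgroup q n C \<phi> \<subseteq> carrier G" by (auto simp: S_subgroup_eq_ratio)
    have "\<one>\<^bsub>G\<^esub> \<in> S_subgroup q n C \<phi>"
      using subgroup.one_closed[OF C] by (simp add: S_subgroup_eq[OF \<phi>] der_one BijGroup_one_apply)
    thus "S_subgroup q n C \<phi> \<noteq> {}" by blast
  next
    fix F assume "F \<in> S_subgroup q n C \<phi>"
    hence F: "F \<in> carrier G" "red F \<in> C"
      and c: "\<And>x. x \<in> Zmod q \<Longrightarrow> [der F x * \<phi> x = \<phi> (red F x)] (mod q)"
      by (auto simp: S_subgroup_eq[OF \<phi>])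
    let ?I = "inv\<^bsub>G\<^esub> F"
    have I: "?I \<in> carrier G" using F by simp
    have "red ?I \<in> C" using F subgroup.m_inv_closed[OF C] by simp
    moreover have "[der ?I y * \<phi> y = \<phi> (red ?I y)] (mod q)" if y: "y \<in> Zmod q" for y
    proof -
      define x where "x = red ?I y"
      have x: "x \<in> Zmod q" unfolding x_def using Bij_apply[OF red_Bij[OF I] y] .
      have Fx: "red F x = y"
        unfolding x_def using F(1) y BijGroup_inv_apply(2)[OF red_Bij] by simp
      have "[der ?I (red F x) * der F x = der (?I \<otimes>\<^bsub>G\<^esub> F) x] (mod q)"
        using cong_sym[OF der_mult[OF I F(1) x]] .
      hence one: "[der ?I y * der F x = 1] (mod q)" using F(1) x by (simp add: Fx der_one)
      have "[der ?I y * \<phi> y = der ?I y * (der F x * \<phi> x)] (mod q)"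
        using c[OF x] by (intro cong_mult cong_refl) (simp add: Fx cong_sym)
      also have "der ?I y * (der F x * \<phi> x) = (der ?I y * der F x) * \<phi> x" by simp
      also have "[(der ?I y * der F x) * \<phi> x = 1 * \<phi> x] (mod q)" by (intro cong_mult one cong_refl)
      finally show ?thesis by (simp add: x_def)
    qed
    ultimately show "?I \<in> S_subgroup q n C \<phi>" using I by (simp add: S_subgroup_eq[OF \<phi>])
  next
    fix F H assume "F \<in> S_subgroup q n C \<phi>" "H \<in> S_subgroup q n C \<phi>"
    hence F: "F \<in> carrier G" "red F \<in> C" and H: "H \<in> carrier G" "red H \<in> C"
      and cF: "\<And>x. x \<in> Zmod q \<Longrightarrow> [der F x * \<phi> x = \<phi> (red F x)] (mod q)"
      and cH: "\<And>x. x \<in> Zmod q \<Longrightarrow> [der H x * \<phi> x = \<phi> (red H x)] (mod q)"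
      by (auto simp: S_subgroup_eq[OF \<phi>])
    have "[der (F \<otimes>\<^bsub>G\<^esub> H) x * \<phi> x = \<phi> (red (F \<otimes>\<^bsub>G\<^esub> H) x)] (mod q)" if x: "x \<in> Zmod q" for x
    proof -
      have "[der (F \<otimes>\<^bsub>G\<^esub> H) x * \<phi> x = (der F (red H x) * der H x) * \<phi> x] (mod q)"
        using der_mult[OF F(1) H(1) x] by (intro cong_mult cong_refl)
      also have "(der F (red H x) * der H x) * \<phi> x = der F (red H x) * (der H x * \<phi> x)" by simp
      also have "[der F (red H x) * (der H x * \<phi> x) = der F (red H x) * \<phi> (red H x)] (mod q)"
        using cH[OF x] by (intro cong_mult cong_refl)
      also have "[der F (red H x) * \<phi> (red H x) = \<phi> (red F (red H x))] (mod q)"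
        using cF Bij_apply[OF red_Bij[OF H(1)] x] .
      finally show ?thesis using F H x by (simp add: red_mult_apply del: hom_mult)
    qed
    thus "F \<otimes>\<^bsub>G\<^esub> H \<in> S_subgroup q n C \<phi>"
      using F H subgroup.m_closed[OF C F(2) H(2)] by (simp add: S_subgroup_eq[OF \<phi>])
  qed
qed

lemma scalar_relE:
  assumes "(\<phi>, \<psi>) \<in> scalar_rel q"
  obtains c where "coprime c q" "\<And>x. x \<in> Zmod q \<Longrightarrow> [\<psi> x = c * \<phi> x] (mod q)"
proof -
  obtain c where c: "c \<in> Zmod q - {\<zero>\<^bsub>R\<^esub>}" "\<psi> = (\<lambda>x\<in>Zmod q. c \<otimes>\<^bsub>R\<^esub> \<phi> x)"
    using assms unfolding scalar_rel_def by blast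
  have "\<not> q dvd c" using c(1) by (auto simp: residue_ring_def zdvd_not_zless)
  hence "coprime c q" using prime_q prime_imp_coprime coprime_commute by metis
  moreover have "[\<psi> x = c * \<phi> x] (mod q)" if "x \<in> Zmod q" for x
    using that by (simp add: c(2)) (simp add: residue_ring_def cong_def)
  ultimately show ?thesis using that by blast
qed

text \<open>A constant factor cancels in the quotient \<open>\<phi>(\<sigma> x) / \<phi>(x)\<close>.\<close>

lemma S_subgroup_scalar_rel:
  assumes "(\<phi>, \<psi>) \<in> scalar_rel q"
  shows "S_subgroup q n C \<phi> = S_subgroup q n C \<psi>"
proof -
  have nz: "\<phi> \<in> nonzero_funs q" "\<psi> \<in> nonzero_funs q" using assms unfolding scalar_rel_def by blast+
  obtain c where c: "coprime c q" "\<And>x. x \<in> Zmod q \<Longrightarrow> [\<psi> x = c * \<phi> x] (mod q)"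
    using scalar_relE[OF assms] by metis
  have "[d * \<phi> x = \<phi> y] (mod q) \<longleftrightarrow> [d * \<psi> x = \<psi> y] (mod q)"
    if "x \<in> Zmod q" "y \<in> Zmod q" for d x y
  proof -
    have "[d * \<psi> x = d * (c * \<phi> x)] (mod q)" using c(2)[OF that(1)] by (intro cong_mult cong_refl)
    hence "[d * \<psi> x = \<psi> y] (mod q) \<longleftrightarrow> [d * (c * \<phi> x) = c * \<phi> y] (mod q)"
      using c(2)[OF that(2)] by (simp add: cong_def)
    also have "\<dots> \<longleftrightarrow> [c * (d * \<phi> x) = c * \<phi> y] (mod q)" by (simp add: mult.left_commute)
    also have "\<dots> \<longleftrightarrow> [d * \<phi> x = \<phi> y] (mod q)" using c(1) by (rule cong_mult_lcancel)
    finally show ?thesis ..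
  qed
  thus ?thesis
    unfolding S_subgroup_eq[OF nz(1)] S_subgroup_eq[OF nz(2)]
    by (intro Collect_cong conj_cong ball_cong refl) (simp add: Bij_apply[OF red_Bij])
qed

lemma cyclic_subgroupsD:
  assumes "C \<in> cyclic_subgroups p (BijGroup (Zmod q))"
  shows "subgroup C (BijGroup (Zmod q))" "card C = p" "C \<subseteq> Bij (Zmod q)"
    "\<exists>x0\<in>Zmod q. bij_betw (\<lambda>\<sigma>. \<sigma> x0) C (Zmod q)"
proof -
  show C: "subgroup C (BijGroup (Zmod q))" "card C = p"
    using assms by (auto simp: cyclic_subgroups_def)
  show "C \<subseteq> Bij (Zmod q)" using subgroup.subset[OF C(1)] by (simp add: carrier_BijGroup)
  show "\<exists>x0\<in>Zmod q. bij_betw (\<lambda>\<sigma>. \<sigma> x0) C (Zmod q)"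
    using C prime_p by (intro prime_order_permutations_regular) (simp_all add: Zmod_eq)
qed

text \<open>The group \<open>C\<close> is recovered as the set of reductions. If \<open>\<phi>\<close> and \<open>\<psi>\<close> have the same coboundary
  on \<open>C\<close>, then \<open>\<psi> / \<phi>\<close> is invariant under \<open>C\<close>, and therefore constant because \<open>C\<close> is transitive.\<close>

lemma S_subgroup_inj:
  assumes C: "C \<in> cyclic_subgroups p (BijGroup (Zmod q))" and D: "D \<in> cyclic_subgroups p (BijGroup (Zmod q))"
    and \<phi>: "\<phi> \<in> nonzero_funs q" and \<psi>: "\<psi> \<in> nonzero_funs q"
    and eq: "S_subgroup q n C \<phi> = S_subgroup q n D \<psi>"
  shows "C = D" "(\<phi>, \<psi>) \<in> scalar_rel q"
proof -
  show "C = D"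
    using red_S_subgroup[OF cyclic_subgroupsD(3)[OF C] \<phi>] red_S_subgroup[OF cyclic_subgroupsD(3)[OF D] \<psi>] eq
    by simp
  obtain x0 where x0: "x0 \<in> Zmod q" and bij: "bij_betw (\<lambda>\<sigma>. \<sigma> x0) C (Zmod q)"
    using cyclic_subgroupsD(4)[OF C] by blast
  have cross: "[\<phi> x * \<psi> x0 = \<psi> x * \<phi> x0] (mod q)" if x: "x \<in> Zmod q" for x
  proof -
    have "x \<in> (\<lambda>\<sigma>. \<sigma> x0) ` C" using bij_betw_imp_surj_on[OF bij] x by simp
    then obtain \<sigma> where \<sigma>: "\<sigma> \<in> C" "\<sigma> x0 = x" by (metis imageE)
    have "\<sigma> \<in> red ` S_subgroup q n C \<phi>"
      using \<sigma>(1) unfolding red_S_subgroup[OF cyclic_subgroupsD(3)[OF C] \<phi>] .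
    then obtain F where F: "F \<in> S_subgroup q n C \<phi>" "red F = \<sigma>" by blast
    have x': "red F x0 = x" using F(2) \<sigma>(2) by simp
    have "F \<in> S_subgroup q n D \<psi>" using F(1) unfolding eq .
    hence 2: "[der F x0 * \<psi> x0 = \<psi> (red F x0)] (mod q)"
      unfolding S_subgroup_eq[OF \<psi>] using x0 by blast
    have 1: "[der F x0 * \<phi> x0 = \<phi> (red F x0)] (mod q)"
      using F(1) x0 unfolding S_subgroup_eq[OF \<phi>] by blast
    note 1 = 1[unfolded x'] and 2 = 2[unfolded x']
    have "[\<phi> x * \<psi> x0 = (der F x0 * \<phi> x0) * \<psi> x0] (mod q)" 
      using cong_sym[OF 1] by (intro cong_mult cong_refl)
    also have "(der F x0 * \<phi> x0) * \<psi> x0 = (der F x0 * \<psi> x0) * \<phi> x0" by simp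
    also have "[(der F x0 * \<psi> x0) * \<phi> x0 = \<psi> x * \<phi> x0] (mod q)" using 2 by (intro cong_mult cong_refl)
    finally show ?thesis .
  qed
  interpret residues_prime p R using prime_p by unfold_locales auto
  have u: "\<phi> x0 \<in> Units R" "\<psi> x0 \<in> Units R"
    using \<phi> \<psi> x0 field_Units by (auto simp: nonzero_funs_def)
  define c where "c = \<psi> x0 \<otimes>\<^bsub>R\<^esub> inv\<^bsub>R\<^esub> (\<phi> x0)"
  have c: "c \<in> Zmod q - {\<zero>\<^bsub>R\<^esub>}"
    unfolding c_def using u field_Units Units_m_closed Units_inv_Units by blast
  have "\<psi> = (\<lambda>x\<in>Zmod q. c \<otimes>\<^bsub>R\<^esub> \<phi> x)"
  proof (rule extensionalityI[of _ "Zmod q"])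
    fix x assume x: "x \<in> Zmod q"
    have car: "\<phi> x \<in> carrier R" "\<psi> x \<in> carrier R" "\<phi> x0 \<in> carrier R" "\<psi> x0 \<in> carrier R"
      using nonzero_funsD(1)[OF \<phi> x] nonzero_funsD(1)[OF \<psi> x]
        nonzero_funsD(1)[OF \<phi> x0] nonzero_funsD(1)[OF \<psi> x0] .
    have "\<phi> x \<otimes>\<^bsub>R\<^esub> \<psi> x0 = \<psi> x \<otimes>\<^bsub>R\<^esub> \<phi> x0"
      using cross[OF x] unfolding res_mult_eq cong_def .
    hence "\<psi> x = (\<phi> x \<otimes>\<^bsub>R\<^esub> \<psi> x0) \<otimes>\<^bsub>R\<^esub> inv\<^bsub>R\<^esub> (\<phi> x0)" using car u by (simp add: m_assoc)
    also have "\<dots> = c \<otimes>\<^bsub>R\<^esub> \<phi> x" unfolding c_def using car u by (simp add: m_ac)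
    finally show "\<psi> x = (\<lambda>x\<in>Zmod q. c \<otimes>\<^bsub>R\<^esub> \<phi> x) x" using x by simp
  qed (use \<psi> in \<open>auto simp: nonzero_funs_iff\<close>)
  thus "(\<phi>, \<psi>) \<in> scalar_rel q" unfolding scalar_rel_def using \<phi> \<psi> c by blast
qed

section \<open>Every Sylow subgroup has the given form\<close>

lemma cong_Zmod_imp_eq: "x \<in> Zmod q \<Longrightarrow> y \<in> Zmod q \<Longrightarrow> [x = y] (mod q) \<Longrightarrow> x = y"
  by (simp add: cong_def Zmod_eq)

lemma fermat_power: "[x ^ (p ^ j) = x] (mod q)" for x :: int
proof (induction j)
  case (Suc j)
  have "[(x ^ (p ^ j)) ^ p = x ^ (p ^ j)] (mod q)" using prime_p by (rule fermat_int_self)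
  hence "[x ^ (p ^ Suc j) = x ^ (p ^ j)] (mod q)" by (simp add: power_mult[symmetric] mult.commute)
  thus ?case using Suc by (rule cong_trans)
qed simp

lemma der_pow:
  assumes F: "F \<in> carrier G" and red: "\<And>x. x \<in> Zmod q \<Longrightarrow> red F x = x" and x: "x \<in> Zmod q"
  shows "[der (F [^]\<^bsub>G\<^esub> (j::nat)) x = der F x ^ j] (mod q)"
proof (induction j)
  case 0
  thus ?case using x by (simp add: der_one)
next
  case (Suc j)
  interpret G: group G by (rule group_G)
  have "[der (F [^]\<^bsub>G\<^esub> j \<otimes>\<^bsub>G\<^esub> F) x = der (F [^]\<^bsub>G\<^esub> j) (red F x) * der F x] (mod q)"
    using F x by (intro der_mult) simp_all
  also have "red F x = x" using red[OF x] .
  also have "[der (F [^]\<^bsub>G\<^esub> j) x * der F x = der F x ^ j * der F x] (mod q)"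
    using Suc by (intro cong_mult cong_refl)
  finally show ?case by (simp add: mult.commute)
qed

text \<open>On elements with trivial reduction the chain rule makes \<open>der\<close> multiplicative pointwise. An
  element of \<open>H\<close> has order a power of \<open>p\<close>, so \<open>(der F x)\<^bsup>p\<^sup>k\<^esup> \<equiv> 1\<close>, while Fermat gives
  \<open>(der F x)\<^bsup>p\<^sup>k\<^esup> \<equiv> der F x\<close>.\<close>

lemma der_eq_one:
  assumes H: "subgroup H G" "card H = p ^ k"
    and F: "F \<in> H" "\<And>x. x \<in> Zmod q \<Longrightarrow> red F x = x" and x: "x \<in> Zmod q"
  shows "der F x = 1"
proof -
  interpret G: group G by (rule group_G)
  interpret H: group "G\<lparr>carrier := H\<rparr>" using H(1) group_G by (rule subgroup.subgroup_is_group)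
  have FG: "F \<in> carrier G" using subgroup.subset[OF H(1)] F(1) by blast
  have "F [^]\<^bsub>G\<^esub> card H = \<one>\<^bsub>G\<^esub>"
    using H.pow_order_eq_1[of F] F(1) by (simp add: Coset.order_def flip: G.nat_pow_consistent)
  hence "[1 = der F x ^ (p ^ k)] (mod q)"
    using der_pow[OF FG F(2) x, of "p ^ k"] x by (simp add: H(2) der_one)
  hence "[1 = der F x] (mod q)" using fermat_power by (rule cong_trans)
  moreover have "der F x \<in> Zmod q" using nonzero_funsD(1)[OF der_nonzero[OF FG] x] .
  moreover have "1 \<in> Zmod q" using q_gt_1 by (simp add: Zmod_eq)
  ultimately show ?thesis using cong_Zmod_imp_eq by metis
qed

text \<open>Two elements with the same reduction differ by an element with trivial reduction, which has
  derivative 1.\<close>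

lemma der_determined_by_red:
  assumes H: "subgroup H G" "card H = p ^ k"
    and F: "F \<in> H" "F' \<in> H" "red F = red F'"
  shows "der F = der F'"
proof -
  interpret group_hom G "BijGroup (Zmod q)" red by (rule red_hom)
  have FG: "F \<in> carrier G" "F' \<in> carrier G" using subgroup.subset[OF H(1)] F by blast+
  define E where "E = inv\<^bsub>G\<^esub> F \<otimes>\<^bsub>G\<^esub> F'"
  have E: "E \<in> H"
    unfolding E_def using F subgroup.m_inv_closed[OF H(1)] subgroup.m_closed[OF H(1)] by blast
  have EG: "E \<in> carrier G" unfolding E_def using FG by simp
  have "red E = \<one>\<^bsub>BijGroup (Zmod q)\<^esub>" unfolding E_def using FG F(3) by simp
  hence red_E: "red E x = x" if "x \<in> Zmod q" for x using that by (simp add: BijGroup_one_apply)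
  have F': "F' = F \<otimes>\<^bsub>G\<^esub> E" unfolding E_def using FG by (simp add: G.m_assoc[symmetric])
  show ?thesis
  proof (rule extensionalityI[of _ "Zmod q"])
    fix x assume x: "x \<in> Zmod q"
    have "[der F' x = der F (red E x) * der E x] (mod q)"
      unfolding F' using FG EG x by (intro der_mult)
    hence "[der F' x = der F x] (mod q)"
      using der_eq_one[OF H E red_E x] red_E[OF x] by simp
    thus "der F x = der F' x"
      using nonzero_funsD(1)[OF der_nonzero[OF FG(1)] x] nonzero_funsD(1)[OF der_nonzero[OF FG(2)] x]
        cong_Zmod_imp_eq by metis
  qed (simp_all add: der_def)
qed

text \<open>Let \<open>N\<close> be the set of elements of \<open>H\<close> with trivial reduction. Its elements share one derivative, so
  \<open>|N| \<le> |flat|\<close>, and \<open>p |flat| = |red ` H| |N|\<close> shows that \<open>|red ` H|\<close> is a power of \<open>p\<close> and at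
  least \<open>p\<close>. Being the order of a group of permutations of \<open>p\<close> points, it divides \<open>p!\<close>, which is
  not divisible by \<open>p\<^sup>2\<close>.\<close>

lemma card_red_image:
  assumes H: "subgroup H G" "card H = p * card flat"
  shows "card (red ` H) = p"
proof -
  interpret group_hom G "BijGroup (Zmod q)" red by (rule red_hom)
  obtain k where k: "card flat = p ^ k" using card_flat by blast
  have cH: "card H = p ^ Suc k" using H(2) k by simp
  have HG: "H \<subseteq> carrier G" using subgroup.subset[OF H(1)] .
  have finH: "finite H" using finite_subset[OF HG finite_G] .
  define N where "N = {F \<in> H. red F = \<one>\<^bsub>BijGroup (Zmod q)\<^esub>}"
  have oneH: "\<one>\<^bsub>G\<^esub> \<in> H" using H(1) by (rule subgroup.one_closed)
  have "N \<subseteq> fibre (red \<one>\<^bsub>G\<^esub>) (der \<one>\<^bsub>G\<^esub>)"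
  proof
    fix F assume "F \<in> N"
    hence F: "F \<in> H" "red F = red \<one>\<^bsub>G\<^esub>" by (simp_all add: N_def)
    thus "F \<in> fibre (red \<one>\<^bsub>G\<^esub>) (der \<one>\<^bsub>G\<^esub>)"
      using der_determined_by_red[OF H(1) cH F(1) oneH F(2)] HG by (auto simp: fibre_def)
  qed
  moreover have "finite (fibre (red \<one>\<^bsub>G\<^esub>) (der \<one>\<^bsub>G\<^esub>))"
    using finite_G by (rule rev_finite_subset) (auto simp: fibre_def)
  moreover have "card (fibre (red \<one>\<^bsub>G\<^esub>) (der \<one>\<^bsub>G\<^esub>)) = card flat"
    using red_Bij[OF G.one_closed] der_nonzero[OF G.one_closed] by (rule card_fibre)
  ultimately have N: "card N \<le> card flat" using card_mono by metis
  have "card H = card (red ` H) * card N"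
  proof (rule card_eq_card_times_fibre[where f = red])
    fix \<sigma> assume "\<sigma> \<in> red ` H"
    then obtain E where E: "E \<in> H" "red E = \<sigma>" by blast
    have EG: "E \<in> carrier G" using E HG by blast
    have \<sigma>B: "\<sigma> \<in> carrier (BijGroup (Zmod q))" using hom_closed[OF EG] E(2) by simp
    have iE: "inv\<^bsub>G\<^esub> E \<in> H" using H(1) E(1) by (rule subgroup.m_inv_closed)
    have "bij_betw (\<lambda>F. E \<otimes>\<^bsub>G\<^esub> F) N {F \<in> H. red F = \<sigma>}"
    proof (rule bij_betw_byWitness[where f' = "\<lambda>F. inv\<^bsub>G\<^esub> E \<otimes>\<^bsub>G\<^esub> F"])
      have "inv\<^bsub>G\<^esub> E \<otimes>\<^bsub>G\<^esub> (E \<otimes>\<^bsub>G\<^esub> F) = F" "E \<otimes>\<^bsub>G\<^esub> (inv\<^bsub>G\<^esub> E \<otimes>\<^bsub>G\<^esub> F) = F" if "F \<in> H" for F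
        using that HG EG by (simp_all add: G.m_assoc[symmetric] subset_iff)
      thus "\<forall>F\<in>N. inv\<^bsub>G\<^esub> E \<otimes>\<^bsub>G\<^esub> (E \<otimes>\<^bsub>G\<^esub> F) = F"
        "\<forall>F\<in>{F \<in> H. red F = \<sigma>}. E \<otimes>\<^bsub>G\<^esub> (inv\<^bsub>G\<^esub> E \<otimes>\<^bsub>G\<^esub> F) = F" by (simp_all add: N_def)
      show "(\<lambda>F. E \<otimes>\<^bsub>G\<^esub> F) ` N \<subseteq> {F \<in> H. red F = \<sigma>}"
      proof (rule image_subsetI)
        fix F assume "F \<in> N"
        hence F: "F \<in> H" "F \<in> carrier G" "red F = \<one>\<^bsub>BijGroup (Zmod q)\<^esub>" using HG by (auto simp: N_def)
        show "E \<otimes>\<^bsub>G\<^esub> F \<in> {F \<in> H. red F = \<sigma>}"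
          using subgroup.m_closed[OF H(1) E(1) F(1)] EG F E(2) \<sigma>B by simp
      qed
      show "(\<lambda>F. inv\<^bsub>G\<^esub> E \<otimes>\<^bsub>G\<^esub> F) ` {F \<in> H. red F = \<sigma>} \<subseteq> N"
      proof (rule image_subsetI)
        fix F assume "F \<in> {F \<in> H. red F = \<sigma>}"
        hence F: "F \<in> H" "F \<in> carrier G" "red F = red E" using HG E by auto
        show "inv\<^bsub>G\<^esub> E \<otimes>\<^bsub>G\<^esub> F \<in> N"
          using subgroup.m_closed[OF H(1) iE F(1)] EG F by (simp add: N_def)
      qed
    qed
    thus "card {F \<in> H. red F = \<sigma>} = card N" by (rule bij_betw_same_card[symmetric])
  qed (use finH in auto)
  hence cards: "p * card flat = card (red ` H) * card N" using H(2) by simp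
  have "p * card flat \<le> card (red ` H) * card flat" unfolding cards using N by simp
  hence ge: "p \<le> card (red ` H)" using card_flat_pos by simp
  have "card (red ` H) dvd p ^ Suc k" using cards k by (metis dvd_triv_left power_Suc)
  then obtain j where j: "card (red ` H) = p ^ j" using prime_p divides_primepow_nat by blast
  have "card (red ` H) dvd Coset.order (BijGroup (Zmod q))"
    using H.lagrange[OF subgroup_img_is_subgroup[OF H(1)]] by (metis dvd_triv_right)
  hence dvd: "p ^ j dvd p * fact (p - 1)"
    using fact_reduce[of p, where ?'a = nat] prime_gt_0_nat[OF prime_p] j
    by (simp add: Coset.order_def carrier_BijGroup card_Bij_Zmod)
  have "j < 2"
  proof (rule ccontr)
    assume "\<not> j < 2"
    hence "p ^ 2 dvd p ^ j" by (intro le_imp_power_dvd) simp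
    hence "p * p dvd p * fact (p - 1)" using dvd dvd_trans unfolding power2_eq_square by blast
    hence "p dvd fact (p - 1)" using prime_gt_0_nat[OF prime_p] by simp
    thus False using prime_dvd_fact_iff[OF prime_p, of "p - 1"] prime_gt_1_nat[OF prime_p] by simp
  qed
  moreover have "j \<noteq> 0" using ge j prime_gt_1_nat[OF prime_p] by (cases j) auto
  ultimately have "j = 1" by simp
  thus ?thesis using j by simp
qed

text \<open>By regularity of \<open>C = red ` H\<close>, every residue is \<open>\<sigma> x0\<close> for exactly one \<open>\<sigma>\<close> in \<open>C\<close>, and the
  elements of \<open>H\<close> over \<open>\<sigma>\<close> share one derivative \<open>u\<^sub>\<sigma>\<close>. So \<open>\<phi>(\<sigma> x0) = u\<^sub>\<sigma>(x0)\<close> defines \<open>\<phi>\<close>. If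
  \<open>x = \<tau> x0\<close>, the cocycle identity \<open>u\<^bsub>\<sigma> \<tau>\<^esub>(x0) = u\<^sub>\<sigma>(x) u\<^sub>\<tau>(x0)\<close> reads \<open>\<phi>(\<sigma> x) = u\<^sub>\<sigma>(x) \<phi>(x)\<close>. This puts
  \<open>H\<close> inside a subgroup of the same order.\<close>

lemma sylow_subgroup_eq_S_subgroup:
  assumes H: "subgroup H G" "card H = p * card flat"
  shows "\<exists>C\<in>cyclic_subgroups p (BijGroup (Zmod q)). \<exists>\<phi>\<in>nonzero_funs q. H = S_subgroup q n C \<phi>"
proof -
  interpret group_hom G "BijGroup (Zmod q)" red by (rule red_hom)
  define C where "C = red ` H"
  have C: "C \<in> cyclic_subgroups p (BijGroup (Zmod q))"
    unfolding cyclic_subgroups_prime[OF group_BijGroup prime_p] C_def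
    using card_red_image[OF H] subgroup_img_is_subgroup[OF H(1)] by simp
  obtain k where "card flat = p ^ k" using card_flat by blast
  hence cH: "card H = p ^ Suc k" using H(2) by simp
  have HG: "F \<in> carrier G" if "F \<in> H" for F using subgroup.subset[OF H(1)] that by blast
  obtain x0 where x0: "x0 \<in> Zmod q" and bij: "bij_betw (\<lambda>\<sigma>. \<sigma> x0) C (Zmod q)"
    using cyclic_subgroupsD(4)[OF C] by blast
  have "\<exists>F\<in>H. red F x0 = y" if y: "y \<in> Zmod q" for y
  proof -
    have "y \<in> (\<lambda>\<sigma>. \<sigma> x0) ` C" using bij_betw_imp_surj_on[OF bij] y by simp
    thus ?thesis unfolding C_def by (auto simp: image_iff)
  qed
  then obtain T where T: "\<And>y. y \<in> Zmod q \<Longrightarrow> T y \<in> H" "\<And>y. y \<in> Zmod q \<Longrightarrow> red (T y) x0 = y"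
    by metis
  define \<phi> where "\<phi> = (\<lambda>y\<in>Zmod q. der (T y) x0)"
  have \<phi>: "\<phi> \<in> nonzero_funs q"
    unfolding nonzero_funs_iff \<phi>_def
    using nonzero_funsD[OF der_nonzero[OF HG[OF T(1)]] x0] by simp
  have orbit: "red F x0 \<in> Zmod q" if "F \<in> H" for F
    using Bij_apply[OF red_Bij[OF HG[OF that]] x0] .
  have \<phi>_orbit: "\<phi> (red F x0) = der F x0" if F: "F \<in> H" for F
  proof -
    note TF = T(1)[OF orbit[OF F]] T(2)[OF orbit[OF F]]
    have "red (T (red F x0)) = red F"
      using bij_betw_imp_inj_on[OF bij] by (rule inj_onD) (use TF F in \<open>simp_all add: C_def\<close>)
    hence "der (T (red F x0)) = der F" using der_determined_by_red[OF H(1) cH TF(1) F] by simp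
    thus ?thesis using orbit[OF F] by (simp add: \<phi>_def)
  qed
  have "H \<subseteq> S_subgroup q n C \<phi>"
  proof
    fix F assume F: "F \<in> H"
    have "[der F x * \<phi> x = \<phi> (red F x)] (mod q)" if x: "x \<in> Zmod q" for x
    proof -
      let ?E = "T x"
      have E: "?E \<in> H" "red ?E x0 = x" using T x by simp_all
      have FE: "F \<otimes>\<^bsub>G\<^esub> ?E \<in> H" using subgroup.m_closed[OF H(1) F E(1)] .
      have "\<phi> (red F x) = der (F \<otimes>\<^bsub>G\<^esub> ?E) x0"
        using \<phi>_orbit[OF FE] red_mult_apply[OF HG[OF F] HG[OF E(1)] x0] by (simp only: E(2))
      moreover have "[der (F \<otimes>\<^bsub>G\<^esub> ?E) x0 = der F (red ?E x0) * der ?E x0] (mod q)"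
        by (rule der_mult[OF HG[OF F] HG[OF E(1)] x0])
      moreover have "\<phi> x = der ?E x0" using \<phi>_orbit[OF E(1)] by (simp only: E(2))
      ultimately show ?thesis using E(2) by (simp add: cong_sym)
    qed
    thus "F \<in> S_subgroup q n C \<phi>" using F HG by (simp add: S_subgroup_eq[OF \<phi>] C_def)
  qed
  moreover have "finite (S_subgroup q n C \<phi>)"
    using finite_G by (rule rev_finite_subset) (auto simp: S_subgroup_eq_ratio)
  moreover have "card H = card (S_subgroup q n C \<phi>)"
    using card_S_subgroup[OF cyclic_subgroupsD(3)[OF C] \<phi>] cyclic_subgroupsD(2)[OF C] H(2) by simp
  ultimately have "H = S_subgroup q n C \<phi>" by (intro card_subset_eq)
  thus ?thesis using C \<phi> by blast
qed

section \<open>The correspondence\<close>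

lemma sylow_subgroups_G: "sylow_subgroups p G = {H. subgroup H G \<and> card H = p * card flat}"
  unfolding sylow_subgroups_def sylow_order ..

text \<open>All members of a class give the same subgroup, so the union over the class serves as the common
  value without choosing a representative.\<close>

definition sylow_of_class :: "(int \<Rightarrow> int) set \<times> (int \<Rightarrow> int) set \<Rightarrow> (int \<Rightarrow> int) set" where
  "sylow_of_class = (\<lambda>(C, X). \<Union>\<phi>\<in>X. S_subgroup q n C \<phi>)"

lemma sylow_of_class_eq:
  assumes "\<phi> \<in> nonzero_funs q"
  shows "sylow_of_class (C, scalar_rel q `` {\<phi>}) = S_subgroup q n C \<phi>"
proof -
  have "\<phi> \<in> scalar_rel q `` {\<phi>}" using equiv_class_self[OF equiv_scalar_rel[OF prime_p] assms] .
  moreover have "\<forall>\<psi>\<in>scalar_rel q `` {\<phi>}. S_subgroup q n C \<psi> = S_subgroup q n C \<phi>"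
    using S_subgroup_scalar_rel by simp
  ultimately show ?thesis unfolding sylow_of_class_def prod.case by (rule UN_constant_eq)
qed

lemma bij_betw_sylow_of_class:
  "bij_betw sylow_of_class
     (cyclic_subgroups p (BijGroup (Zmod q)) \<times> (nonzero_funs q // scalar_rel q))
     (sylow_subgroups p G)"
  unfolding bij_betw_def
proof
  note eqv = equiv_scalar_rel[OF prime_p]
  let ?D = "cyclic_subgroups p (BijGroup (Zmod q)) \<times> (nonzero_funs q // scalar_rel q)"
  have dom: "\<exists>C \<phi>. a = (C, scalar_rel q `` {\<phi>}) \<and> C \<in> cyclic_subgroups p (BijGroup (Zmod q)) \<and>
      \<phi> \<in> nonzero_funs q" if "a \<in> ?D" for a
    using that by (auto elim!: quotientE)
  show "inj_on sylow_of_class ?D"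
  proof (rule inj_onI)
    fix a b assume a: "a \<in> ?D" and b: "b \<in> ?D" and eq: "sylow_of_class a = sylow_of_class b"
    obtain C \<phi> where C: "a = (C, scalar_rel q `` {\<phi>})" "C \<in> cyclic_subgroups p (BijGroup (Zmod q))"
      "\<phi> \<in> nonzero_funs q" using dom[OF a] by blast
    obtain D \<psi> where D: "b = (D, scalar_rel q `` {\<psi>})" "D \<in> cyclic_subgroups p (BijGroup (Zmod q))"
      "\<psi> \<in> nonzero_funs q" using dom[OF b] by blast
    have "S_subgroup q n C \<phi> = S_subgroup q n D \<psi>"
      using eq unfolding C(1) D(1) sylow_of_class_eq[OF C(3)] sylow_of_class_eq[OF D(3)] .
    from S_subgroup_inj[OF C(2) D(2) C(3) D(3) this] show "a = b"
      unfolding C(1) D(1) using equiv_class_eq[OF eqv] by blast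
  qed
  show "sylow_of_class ` ?D = sylow_subgroups p G"
  proof
    show "sylow_of_class ` ?D \<subseteq> sylow_subgroups p G"
    proof (rule image_subsetI)
      fix a assume "a \<in> ?D"
      then obtain C \<phi> where C: "a = (C, scalar_rel q `` {\<phi>})"
        "C \<in> cyclic_subgroups p (BijGroup (Zmod q))" "\<phi> \<in> nonzero_funs q" using dom by blast
      show "sylow_of_class a \<in> sylow_subgroups p G"
        unfolding C(1) sylow_of_class_eq[OF C(3)] sylow_subgroups_G
        using subgroup_S_subgroup[OF cyclic_subgroupsD(1)[OF C(2)] C(3)]
          card_S_subgroup[OF cyclic_subgroupsD(3)[OF C(2)] C(3)] cyclic_subgroupsD(2)[OF C(2)]
        by simp
    qed
    show "sylow_subgroups p G \<subseteq> sylow_of_class ` ?D"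
    proof
      fix H assume "H \<in> sylow_subgroups p G"
      then obtain C \<phi> where C: "C \<in> cyclic_subgroups p (BijGroup (Zmod q))" "\<phi> \<in> nonzero_funs q"
        "H = S_subgroup q n C \<phi>"
        unfolding sylow_subgroups_G using sylow_subgroup_eq_S_subgroup by blast
      have "(C, scalar_rel q `` {\<phi>}) \<in> ?D" using C(1,2) by (simp add: quotientI)
      moreover have "H = sylow_of_class (C, scalar_rel q `` {\<phi>})"
        unfolding C(3) sylow_of_class_eq[OF C(2)] ..
      ultimately show "H \<in> sylow_of_class ` ?D" by blast
    qed
  qed
qed

end

theorem corollary5p2:
  fixes p n :: nat
  assumes "prime p" and "n \<ge> 2"
  shows "\<exists>B. bij_betw B
           (cyclic_subgroups p (BijGroup (Zmod (int p))) \<times> (nonzero_funs (int p) // scalar_rel (int p)))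
           (sylow_subgroups p (poly_perm_group (int p ^ n))) \<and>
         (\<forall>C \<in> cyclic_subgroups p (BijGroup (Zmod (int p))). \<forall>\<phi> \<in> nonzero_funs (int p).
            B (C, scalar_rel (int p) `` {\<phi>}) = S_subgroup (int p) n C \<phi>)"
proof -
  interpret prime_power_modulus p n using assms by unfold_locales
  show ?thesis using bij_betw_sylow_of_class sylow_of_class_eq by (intro exI[of _ sylow_of_class]) simp
qed

end
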